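(* Let $K\ge1$, $s\ge0$, $1\le R_1,R_2\le K$, and let $\Lambda=(\mathbf x,\mathcal P,\phi)$ be a substructure of $\mathrm{AR}(K,R_1,R_2,s)$ such that the functional digraph of $\phi$ on the vertex set $\mathcal H\cup\mathcal P$ is a rooted forest with root vertices $\mathcal P$. Then the number of arrowed arrays in $\mathrm{AR}(K,R_1,R_2,s)$ belonging to $\Lambda$ is \[ T(\Lambda)=\sum_{A=0}^{\min(s,K)-1}\frac{(s-P+R_1)\,(K-A-1)!\,(s-A-1)!\,(P-1)!}{(P-R_1-A)!\,(K-R_2-A)!\,(R_1-1)!\,(R_2-1)!}, \] where $P=|\mathcal P|$.
   Context: Two-row vertical arrays: for $K\ge1$, $s\ge0$, $1\le R_1,R_2\le K$, such an array is a $2\times K$ grid of cells, each cell containing a possibly empty left-to-right ordered list of unlabelled vertices, each row containing $s$ vertices, the vertices partitioned into $s$ pairs each consisting of one vertex of row 1 and one of row 2 (partners), with exactly $R_1$ marked cells in row 1 and $R_2$ in row 2. Arrays are equal if they have the same vertex counts per cell, marked cells and pairing of vertex positions. Arrowed array: a pair $(\alpha,\phi)$ where $\alpha$ is such an array and $\phi$ is a function from a subset $\mathcal H\subseteq\{1,\dots,K\}\setminus\mathcal R_1$ to $\{1,\dots,K\}$, $\mathcal R_1$ being the set of marked columns of row 1. Forest condition: let $\mathcal F_i$ be the set of columns whose row-$i$ cell is nonempty and $\mathcal R_2$ the marked columns of row 2; define $\psi_1$ on $(\mathcal H\cup\mathcal F_1)\setminus\mathcal R_1$ by $\psi_1(j)=\phi(j)$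 for $j\in\mathcal H$ and, for $j\in\mathcal F_1\setminus(\mathcal H\cup\mathcal R_1)$, $\psi_1(j)=$ the column of the partner of the rightmost vertex of cell $(1,j)$; define $\psi_2$ on $\mathcal F_2\setminus\mathcal R_2$ by $\psi_2(j)=$ the column of the partner of the rightmost vertex of cell $(2,j)$. The forest condition holds if for $i=1,2$ every $j$ in the domain of $\psi_i$ has some $t\ge1$ with $\psi_i^t(j)$ defined and in $\mathcal R_i$. $\mathrm{AR}(K,R_1,R_2,s)$ is the set of arrowed arrays satisfying the forest condition. The balance condition for an arrowed array: for every column $j$, cells $(1,j)$ and $(2,j)$ contain equally many vertices. Substructure $\Lambda$: let $\mathcal P\subseteq\{1,\dots,K\}$ with $|\mathcal P|\ge R_1$, let $\mathbf x=(x_1,\dots,x_K)$ be non-negative integers, and let $\phi$ be a function from a subset $\mathcal H\subseteq\{1,\dots,K\}\setminus\mathcal P$ to $\mathcal H\cup\mathcal P$, such that $x_j=0$ for $j\notin\mathcal H\cup\mathcal P$ and $\sum_jx_j=s-|\mathcal P|+R_1$. Then $\Lambda=(\mathbf x,\mathcal P,\phi)$ is the set of $(\alpha,\phi')\in\mathrm{AR}(K,R_1,R_2,s)$ satisfying the balance condition, with $\phi'=\phi$, with the set of marked cells of row 1 contained in $\mathcal P$, and such that for each column $j\in\mathcal H\cup\mathcal P$ both cells $(1,j)$ and $(2,j)$ contain $x_j+1$ vertices if $j\in\mathcal P$ and cell $(1,j)$ is unmarked, and $x_j$ vertices otherwise. $T(\Lambda)$ is its cardinality. Any term with the factorial of a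 negative integer in its denominator is $0$.
   Formalization: The formal theorem assumes s ≥ 1 instead of s ≥ 0: for s = 0 every substructure of this kind has T(Λ) = binom(K, R_2) > 0, while the sum on the right is empty and equals 0. *)

theory Defs
  imports Complex_Main
begin

text \<open>
  Columns are numbered 1, ..., K. The vertices of a row are identified with their positions:
  (j, k) is the k-th vertex from the left (counting from 0) in the cell of column j.
  The pairing is the set of pairs (v, w) of partners, with v in row 1 and w in row 2.
  Counts and marks are required below to vanish outside the columns 1, ..., K, so that equality of
  arrays is equality of records.
\<close>

type_synonym vertex = "nat \<times> nat"

record varray =
  cnt1 :: "nat \<Rightarrow> nat"
  cnt2 :: "nat \<Rightarrow> nat"
  marks1 :: "nat set"
  marks2 :: "nat set"
  pairing :: "(vertex \<times> vertex) set"

definition row_vertices :: "nat \<Rightarrow> (nat \<Rightarrow> nat) \<Rightarrow> vertex set" where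
  "row_vertices K c = (SIGMA j:{1..K}. {..<c j})"

definition vertical_array :: "nat \<Rightarrow> nat \<Rightarrow> nat \<Rightarrow> nat \<Rightarrow> varray \<Rightarrow> bool" where
  "vertical_array K R1 R2 s \<alpha> \<longleftrightarrow>
     (\<forall>j. j \<notin> {1..K} \<longrightarrow> cnt1 \<alpha> j = 0 \<and> cnt2 \<alpha> j = 0) \<and>
     (\<Sum>j\<in>{1..K}. cnt1 \<alpha> j) = s \<and> (\<Sum>j\<in>{1..K}. cnt2 \<alpha> j) = s \<and>
     marks1 \<alpha> \<subseteq> {1..K} \<and> card (marks1 \<alpha>) = R1 \<and>
     marks2 \<alpha> \<subseteq> {1..K} \<and> card (marks2 \<alpha>) = R2 \<and>
     pairing \<alpha> \<subseteq> row_vertices K (cnt1 \<alpha>) \<times> row_vertices K (cnt2 \<alpha>) \<and>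
     (\<forall>v\<in>row_vertices K (cnt1 \<alpha>). \<exists>!w. (v, w) \<in> pairing \<alpha>) \<and>
     (\<forall>w\<in>row_vertices K (cnt2 \<alpha>). \<exists>!v. (v, w) \<in> pairing \<alpha>)"

definition partner1 :: "varray \<Rightarrow> vertex \<Rightarrow> vertex" where
  "partner1 \<alpha> v = (THE w. (v, w) \<in> pairing \<alpha>)"

definition partner2 :: "varray \<Rightarrow> vertex \<Rightarrow> vertex" where
  "partner2 \<alpha> w = (THE v. (v, w) \<in> pairing \<alpha>)"

text \<open>
  The partial function of arrows is a map; its domain is the set H of columns carrying an arrow.
\<close>

type_synonym arrowed_array = "varray \<times> (nat \<rightharpoonup> nat)"

definition psi1 :: "arrowed_array \<Rightarrow> (nat \<rightharpoonup> nat)" where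
  "psi1 = (\<lambda>(\<alpha>, \<phi>) j.
     if j \<in> marks1 \<alpha> then None
     else if j \<in> dom \<phi> then \<phi> j
     else if cnt1 \<alpha> j > 0 then Some (fst (partner1 \<alpha> (j, cnt1 \<alpha> j - 1)))
     else None)"

definition psi2 :: "arrowed_array \<Rightarrow> (nat \<rightharpoonup> nat)" where
  "psi2 = (\<lambda>(\<alpha>, \<phi>) j.
     if j \<notin> marks2 \<alpha> \<and> cnt2 \<alpha> j > 0 then Some (fst (partner2 \<alpha> (j, cnt2 \<alpha> j - 1)))
     else None)"

definition leads_to :: "(nat \<rightharpoonup> nat) \<Rightarrow> nat set \<Rightarrow> bool" where
  "leads_to \<psi> R \<longleftrightarrow> (\<forall>j\<in>dom \<psi>. \<exists>t\<ge>1. \<exists>r\<in>R. (j, r) \<in> Map.graph \<psi> ^^ t)"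

definition forest_condition :: "arrowed_array \<Rightarrow> bool" where
  "forest_condition a \<longleftrightarrow>
     leads_to (psi1 a) (marks1 (fst a)) \<and> leads_to (psi2 a) (marks2 (fst a))"

definition AR :: "nat \<Rightarrow> nat \<Rightarrow> nat \<Rightarrow> nat \<Rightarrow> arrowed_array set" where
  "AR K R1 R2 s = {(\<alpha>, \<phi>).
     vertical_array K R1 R2 s \<alpha> \<and>
     dom \<phi> \<subseteq> {1..K} - marks1 \<alpha> \<and> ran \<phi> \<subseteq> {1..K} \<and>
     forest_condition (\<alpha>, \<phi>)}"

definition balanced :: "nat \<Rightarrow> arrowed_array \<Rightarrow> bool" where
  "balanced K a \<longleftrightarrow> (\<forall>j\<in>{1..K}. cnt1 (fst a) j = cnt2 (fst a) j)"

text \<open>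
  The parameters of a substructure. Only the values of x on the columns 1, ..., K matter.
\<close>

definition substructure_params ::
  "nat \<Rightarrow> nat \<Rightarrow> nat \<Rightarrow> (nat \<Rightarrow> nat) \<Rightarrow> nat set \<Rightarrow> (nat \<rightharpoonup> nat) \<Rightarrow> bool" where
  "substructure_params K R1 s x P \<phi> \<longleftrightarrow>
     P \<subseteq> {1..K} \<and> card P \<ge> R1 \<and>
     dom \<phi> \<subseteq> {1..K} - P \<and> ran \<phi> \<subseteq> dom \<phi> \<union> P \<and>
     (\<forall>j\<in>{1..K}. j \<notin> dom \<phi> \<union> P \<longrightarrow> x j = 0) \<and>
     int (\<Sum>j\<in>{1..K}. x j) = int s - int (card P) + int R1"

definition substructure ::
  "nat \<Rightarrow> nat \<Rightarrow> nat \<Rightarrow> nat \<Rightarrow> (nat \<Rightarrow> nat) \<Rightarrow> nat set \<Rightarrow> (nat \<rightharpoonup> nat) \<Rightarrow> arrowed_array set" where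
  "substructure K R1 R2 s x P \<phi> = {(\<alpha>, \<phi>'). (\<alpha>, \<phi>') \<in> AR K R1 R2 s \<and>
     balanced K (\<alpha>, \<phi>') \<and> \<phi>' = \<phi> \<and> marks1 \<alpha> \<subseteq> P \<and>
     (\<forall>j\<in>dom \<phi> \<union> P.
        let n = (if j \<in> P \<and> j \<notin> marks1 \<alpha> then x j + 1 else x j)
        in cnt1 \<alpha> j = n \<and> cnt2 \<alpha> j = n)}"

text \<open>
  A digraph with vertex set V and arc set E is a rooted forest, with arcs directed towards the
  roots, if it is acyclic and every vertex has at most one outgoing arc; the roots are the
  vertices without outgoing arc.
\<close>

definition rooted_forest :: "'a set \<Rightarrow> ('a \<times> 'a) set \<Rightarrow> 'a set \<Rightarrow> bool" where
  "rooted_forest V E roots \<longleftrightarrow>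
     finite V \<and> E \<subseteq> V \<times> V \<and> acyclic E \<and>
     (\<forall>u v w. (u, v) \<in> E \<longrightarrow> (u, w) \<in> E \<longrightarrow> v = w) \<and>
     roots = {v \<in> V. \<forall>w. (v, w) \<notin> E}"

text \<open>
  Reciprocal of the factorial; it is 0 on negative integers, which implements the convention
  that a term with the factorial of a negative integer in its denominator is 0.
\<close>

definition inv_fact :: "int \<Rightarrow> real" where
  "inv_fact n = (if n < 0 then 0 else 1 / fact (nat n))"

end

theory Submission
  imports Defs "HOL-Combinatorics.Permutations" "HOL-Library.FuncSet"
begin

text \<open>
  Fix the marked set \<open>R\<close> of row 1. The cell sizes are then determined, and an arrowed array is a
  marked set \<open>S\<close> of row 2 together with a bijection \<open>\<sigma>\<close> of the \<open>s\<close> vertices of row 1 onto those of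
  row 2. Contracting the arrows, row 1 asks that \<open>p \<mapsto> root of the column of \<sigma> (last vertex of p)\<close>
  has no cycle on \<open>P - R\<close>; row 2 asks that \<open>f j = column of \<sigma>\<inverse> (last vertex of j)\<close> has no cycle
  outside \<open>S\<close>.

  Inclusion and exclusion over unions \<open>C\<close> of cycles of \<open>f\<close> turns the second condition into a sum of
  signs of \<open>f\<close> on \<open>C\<close>, and the sum over \<open>S\<close> contributes a binomial coefficient depending only on
  \<open>card C\<close>. Call a vertex of row 1 free if it is not the last vertex of a column in \<open>P - R\<close>. If two
  free vertices are matched with last vertices of columns in \<open>C\<close>, exchanging their images is a
  sign-reversing involution; if none is, the condition on row 1 fails. What remains is one free
  vertex, in which case \<open>f\<close> is a single cycle on \<open>C\<close>, and two applications of the formula for the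
  number of bijections inducing a forest count these terms. Summation by parts gives the stated sum.
\<close>

text \<open>Both conditions bear on the same \<sigma>, and for fixed \<open>R\<close> the count
  depends on \<phi> and on the numbers \<open>x j\<close>; this dependence has to cancel. For fixed
  \<open>C\<close>, summing over the position of the free vertex leaves only \<open>card C\<close>
  and the number w of vertices in columns with root in \<open>R\<close>. Since w is the sum of
  \<open>x j\<close> over these columns, and each root lies in equally many sets \<open>R\<close>,
  summing over \<open>R\<close> produces the total of all \<open>x j\<close>, which is the factor s
  - P + R1. The index A arises as follows. With q = P - R1, the terms in which \<open>C\<close>
  consists of m columns of \<open>P - R\<close> and the column of the free vertex contribute w (a(m)
  - a(m+1)) times a binomial coefficient, where a(m) is q!/(q-m)! times (s-m-1)!. Summation by parts
  moves the difference onto the binomials counting the sets \<open>S\<close>, which is why K - A - 1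
  and R2 - 1 appear.\<close>

subsection \<open>Maps without cycles\<close>

text \<open>Equivalently, iterating \<open>f\<close> takes every element of \<open>D\<close> out of \<open>D\<close>.\<close>

definition acyclic_on :: "'a set \<Rightarrow> ('a \<Rightarrow> 'a) \<Rightarrow> bool" where
  "acyclic_on D f \<longleftrightarrow> (\<forall>E\<subseteq>D. f ` E \<subseteq> E \<longrightarrow> E = {})"

lemma acyclic_onD: "acyclic_on D f \<Longrightarrow> E \<subseteq> D \<Longrightarrow> (\<And>x. x \<in> E \<Longrightarrow> f x \<in> E) \<Longrightarrow> E = {}"
  by (simp add: acyclic_on_def image_subset_iff)

lemma acyclic_on_empty [simp]: "acyclic_on {} f"
  by (auto simp: acyclic_on_def)

lemma acyclic_on_cong:
  assumes "\<And>x. x \<in> D \<Longrightarrow> f x = g x"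
  shows "acyclic_on D f \<longleftrightarrow> acyclic_on D g"
proof -
  have "f ` E = g ` E" if "E \<subseteq> D" for E
    using that assms by (intro image_cong) auto
  then show ?thesis unfolding acyclic_on_def by simp
qed

lemma acyclic_on_singleton: "acyclic_on {p} f \<longleftrightarrow> f p \<noteq> p"
proof
  assume "acyclic_on {p} f"
  then show "f p \<noteq> p" using acyclic_onD[of "{p}" f "{p}"] by auto
next
  assume "f p \<noteq> p"
  then have "E = {}" if "E \<subseteq> {p}" "f ` E \<subseteq> E" for E
    using that by (cases "E = {p}") auto
  then show "acyclic_on {p} f" unfolding acyclic_on_def by simp
qed

lemma acyclic_on_subset: "acyclic_on D f \<Longrightarrow> D' \<subseteq> D \<Longrightarrow> acyclic_on D' f"
  by (simp add: acyclic_on_def)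

text \<open>A closed set of the contracted map becomes closed under \<open>g\<close> once all
  elements of \<open>H\<close> with root in it are added. Conversely, in a set closed under
  \<open>g\<close>, the elements of \<open>H\<close> whose root escapes form a closed subset of
  \<open>H\<close>, so there are none, and the set is closed under \<open>rt\<close>. The lemma
  serves to contract the arrows of row 1, and also the columns already exposed during a
  count.\<close>

lemma acyclic_on_contract:
  assumes H: "acyclic_on H g"
    and rt_step: "\<And>x. x \<in> H \<Longrightarrow> rt (g x) = rt x"
    and rt_notin: "\<And>x. x \<in> H \<Longrightarrow> rt x \<notin> H"
    and rt_id: "\<And>x. x \<notin> H \<Longrightarrow> rt x = x"
  shows "acyclic_on (H \<union> Q) g \<longleftrightarrow> acyclic_on Q (rt \<circ> g)"
proof
  assume a: "acyclic_on (H \<union> Q) g"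
  show "acyclic_on Q (rt \<circ> g)"
    unfolding acyclic_on_def
  proof (intro allI impI)
    fix D assume D: "D \<subseteq> Q" "(rt \<circ> g) ` D \<subseteq> D"
    have "D \<union> {x\<in>H. rt x \<in> D} = {}"
    proof (rule acyclic_onD[OF a])
      fix x assume "x \<in> D \<union> {x\<in>H. rt x \<in> D}"
      then have "rt (g x) \<in> D" using D rt_step by auto
      then show "g x \<in> D \<union> {x\<in>H. rt x \<in> D}" using rt_id by (cases "g x \<in> H") auto
    qed (use D in auto)
    then show "D = {}" by auto
  qed
next
  assume a: "acyclic_on Q (rt \<circ> g)"
  show "acyclic_on (H \<union> Q) g"
    unfolding acyclic_on_def
  proof (intro allI impI)
    fix D assume D: "D \<subseteq> H \<union> Q" "g ` D \<subseteq> D"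
    have "{x\<in>D\<inter>H. rt x \<notin> D} = {}"
    proof (rule acyclic_onD[OF H])
      fix x assume x: "x \<in> {x\<in>D\<inter>H. rt x \<notin> D}"
      then have "g x \<in> D" using D by auto
      moreover have "rt (g x) \<notin> D" using x rt_step by auto
      ultimately show "g x \<in> {x\<in>D\<inter>H. rt x \<notin> D}"
        using rt_id[of "g x"] by fastforce
    qed auto
    then have rtD: "rt x \<in> D" if "x \<in> D" for x
      using that rt_id[of x] by (cases "x \<in> H") auto
    have rtDQ: "rt x \<in> D \<inter> Q" if "x \<in> D" for x
      using rtD[OF that] rt_notin[of x] rt_id[of x] D that by (cases "x \<in> H") auto
    have "D \<inter> Q = {}"
      by (rule acyclic_onD[OF a]) (use rtDQ D in auto)
    then show "D = {}" using rtDQ by auto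
  qed
qed

text \<open>The root is the first iterate outside \<open>H\<close>; an orbit that stayed in
  \<open>H\<close> would be a nonempty closed subset.\<close>

lemma acyclic_on_exists_root:
  assumes H: "acyclic_on H g"
  shows "\<exists>rt. (\<forall>x\<in>H. rt (g x) = rt x \<and> rt x \<notin> H) \<and> (\<forall>x. x \<notin> H \<longrightarrow> rt x = x)"
proof -
  define n where "n x = (LEAST n. (g ^^ n) x \<notin> H)" for x
  define rt where "rt x = (g ^^ n x) x" for x
  have ex: "\<exists>n. (g ^^ n) x \<notin> H" for x
  proof (rule ccontr)
    assume a: "\<not> ?thesis"
    have "range (\<lambda>n. (g ^^ n) x) = {}"
    proof (rule acyclic_onD[OF H])
      fix y assume "y \<in> range (\<lambda>n. (g ^^ n) x)"
      then obtain n where "y = (g ^^ n) x" by auto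
      then have "g y = (g ^^ Suc n) x" by simp
      then show "g y \<in> range (\<lambda>n. (g ^^ n) x)" by blast
    qed (use a in auto)
    then show False by auto
  qed
  have "n x = 0" if "x \<notin> H" for x
    unfolding n_def by (rule Least_eq_0) (use that in simp)
  moreover have "n x = Suc (n (g x))" if "x \<in> H" for x
  proof -
    obtain k where k: "(g ^^ k) x \<notin> H" using ex by blast
    show ?thesis unfolding n_def
      by (subst Least_Suc[where P = "\<lambda>n. (g ^^ n) x \<notin> H", OF k]) (use that in \<open>simp_all del: funpow.simps add: funpow_Suc_right\<close>)
  qed
  moreover have "rt x \<notin> H" for x
    unfolding rt_def n_def using ex by (rule LeastI_ex)
  ultimately show ?thesis
    by (intro exI[of _ rt]) (auto simp: rt_def funpow_Suc_right simp del: funpow.simps(2))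
qed

section \<open>Signs of cycles and inclusion-exclusion over unions of cycles\<close>

lemma sign_on_disjoint_Un:
  assumes "finite A" "finite B" "A \<inter> B = {}" "f ` A = A" "f ` B = B"
  shows "sign_on (A \<union> B) f = sign_on A f * sign_on B f"
proof -
  have p: "restrict_id f C permutes C" if "finite C" "f ` C = C" for C
    using that by (intro permutes_restrict_id) (simp add: bij_betw_def eq_card_imp_inj_on)
  have "restrict_id f (A \<union> B) = restrict_id f A \<circ> restrict_id f B"
    using assms by (auto simp: restrict_id_def fun_eq_iff)
  then show ?thesis
    unfolding sign_on_def using sign_compose[OF permutes_imp_permutation permutes_imp_permutation] p assms by metis
qed

text \<open>The last hypothesis says that \<open>p\<close> is a single cycle, without enumerating
  it. The induction cuts one point out of the cycle at the cost of one transposition. The exponent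
  is \<open>card D + 1\<close> instead of \<open>card D - 1\<close> to avoid truncated
  subtraction.\<close>

lemma sign_cycle:
  assumes "finite D" "D \<noteq> {}" "p permutes D"
    and "\<And>E. E \<subseteq> D \<Longrightarrow> E \<noteq> {} \<Longrightarrow> p ` E \<subseteq> E \<Longrightarrow> E = D"
  shows "sign p = (-1) ^ (card D + 1)"
  using assms
proof (induction "card D" arbitrary: D p)
  case 0
  then show ?case by simp
next
  case (Suc m)
  show ?case
  proof (cases "m = 0")
    case True
    with Suc obtain x where "D = {x}" by (metis One_nat_def card_1_singletonE)
    then have "p = id" using Suc by (simp add: permutes_sing)
    then show ?thesis using \<open>D = {x}\<close> by simp
  next
    case False
    obtain x where x: "x \<in> D" using Suc by auto
    define D' where "D' = D - {x}"
    define y where "y = p x"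
    \<comment> \<open>\<open>q\<close> fixes \<open>x\<close> and sends the predecessor of
      \<open>x\<close> straight to \<open>y\<close>: the same cycle with \<open>x\<close>
      bypassed.\<close>
    define q where "q = transpose x y \<circ> p"
    have cD'1: "card D' = m" using Suc.hyps(2) Suc.prems(1) x by (simp add: D'_def)
    then have cD': "card D' = m" "D' \<noteq> {}" using False by auto
    have yD: "y \<in> D" using x Suc unfolding y_def by (simp add: permutes_in_image)
    have yx: "y \<noteq> x"
    proof
      assume "y = x"
      then have "{x} = D" using Suc.prems(4)[of "{x}"] x y_def by auto
      then show False using cD' D'_def by auto
    qed
    have pq: "p = transpose x y \<circ> q" unfolding q_def by (simp add: o_assoc)
    have qD: "q permutes D" unfolding q_def using Suc x yD
      by (intro permutes_compose permutes_swap_id) auto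
    have qx: "q x = x" by (simp add: q_def y_def)
    have qD': "q permutes D'" unfolding D'_def
      by (rule permutes_superset[OF qD]) (use qx in auto)
    have qz: "q z = (if p z = x then y else p z)" if "z \<in> D'" for z
    proof -
      have "p z \<noteq> y" using that inj_eq[OF permutes_inj[OF Suc.prems(3)]] unfolding y_def D'_def by auto
      then show ?thesis unfolding q_def by (auto simp: transpose_def)
    qed
    \<comment> \<open>A \<open>q\<close>-closed set containing \<open>y\<close> becomes
      \<open>p\<close>-closed when \<open>x\<close> is added. One avoiding \<open>y\<close> does not
      contain the predecessor of \<open>x\<close>, so it is \<open>p\<close>-closed already.\<close>
    have irr: "E = D'" if E: "E \<subseteq> D'" "E \<noteq> {}" "q ` E \<subseteq> E" for E
    proof (cases "y \<in> E")
      case True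
      have "p ` (insert x E) \<subseteq> insert x E"
      proof
        fix w assume "w \<in> p ` insert x E"
        then obtain z where "w = p z" "z \<in> insert x E" by auto
        then show "w \<in> insert x E"
          using True E(1,3) qz[of z] y_def
          by (cases "z = x") (auto simp: image_subset_iff subset_iff split: if_splits)
      qed
      then have "insert x E = D" using Suc.prems(4)[of "insert x E"] E x D'_def by auto
      then show ?thesis using E D'_def by auto
    next
      case False
      have "p ` E \<subseteq> E"
      proof
        fix w assume "w \<in> p ` E"
        then obtain z where "w = p z" "z \<in> E" by auto
        then show "w \<in> E"
          using False E(1,3) qz[of z] by (auto simp: image_subset_iff subset_iff split: if_splits)
      qed
      then have "E = D" using Suc.prems(4)[of E] E D'_def by auto
      then show ?thesis using E D'_def x by auto
    qed
    have "sign q = (-1) ^ (card D' + 1)"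
      using Suc.hyps(1)[of D' q] cD' qD' irr Suc.prems(1) D'_def by auto
    moreover have "sign p = sign (transpose x y) * sign q"
      using sign_compose[OF permutation_swap_id permutes_imp_permutation[OF Suc.prems(1) qD], of x y] pq
      by simp
    ultimately show ?thesis using yx cD'(1) Suc.hyps(2)[symmetric] by (simp add: sign_swap_id)
  qed
qed

text \<open>This is \<open>(-1)\<close> to the number of cycles when \<open>f\<close> permutes \<open>C\<close>.\<close>

definition cyc_weight :: "('a \<Rightarrow> 'a) \<Rightarrow> 'a set \<Rightarrow> int" where
  "cyc_weight f C = (-1) ^ card C * sign_on C f"

lemma cyc_weight_cycle:
  assumes "finite D" "D \<noteq> {}" "f ` D = D"
    and "\<And>E. E \<subseteq> D \<Longrightarrow> E \<noteq> {} \<Longrightarrow> f ` E \<subseteq> E \<Longrightarrow> E = D"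
  shows "cyc_weight f D = -1"
proof -
  have "restrict_id f D permutes D"
    using assms by (intro permutes_restrict_id) (simp add: bij_betw_def eq_card_imp_inj_on)
  moreover have "restrict_id f D ` E = f ` E" if "E \<subseteq> D" for E
    using that by (intro image_cong) (auto simp: restrict_id_def)
  ultimately have "sign_on D f = (-1) ^ (card D + 1)"
    unfolding sign_on_def using assms by (intro sign_cycle) auto
  then show ?thesis by (simp add: cyc_weight_def flip: power_add)
qed

text \<open>Without a cycle only the empty set is counted. Otherwise a minimal nonempty closed set
  \<open>D0\<close> is a single cycle, every invariant \<open>C\<close> contains or misses it, and
  adding \<open>D0\<close> multiplies the weight by -1, so the sum cancels in pairs.\<close>

lemma acyclic_on_indicator:
  assumes "finite D"
  shows "(if acyclic_on D f then 1 else 0) = (\<Sum>C | C \<subseteq> D \<and> f ` C = C. cyc_weight f C)"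
proof (cases "acyclic_on D f")
  case True
  have "{C. C \<subseteq> D \<and> f ` C = C} = {{}}"
    using True unfolding acyclic_on_def by auto
  then show ?thesis using True by (simp add: cyc_weight_def sign_on_def restrict_id_def)
next
  case False
  define \<C> where "\<C> = {E. E \<subseteq> D \<and> f ` E \<subseteq> E \<and> E \<noteq> {}}"
  have "finite \<C>" unfolding \<C>_def by (rule finite_subset[of _ "Pow D"]) (use assms in auto)
  moreover have "\<C> \<noteq> {}" using False unfolding \<C>_def acyclic_on_def by auto
  ultimately obtain D0 where D0: "D0 \<in> \<C>" "\<And>E. E \<in> \<C> \<Longrightarrow> E \<subseteq> D0 \<Longrightarrow> E = D0"
    by (metis finite_has_minimal)
  have fin: "finite C" if "C \<subseteq> D" for C using that assms finite_subset by auto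
  have D0': "D0 \<subseteq> D" "D0 \<noteq> {}" "f ` D0 \<subseteq> D0" "finite D0" using D0 fin unfolding \<C>_def by auto
  have irr: "E = D0" if "E \<subseteq> D0" "E \<noteq> {}" "f ` E \<subseteq> E" for E
    using D0(2)[of E] that D0' unfolding \<C>_def by auto
  have fD0: "f ` D0 = D0" using irr[of "f ` D0"] D0' by (simp add: image_mono)
  have w0: "cyc_weight f D0 = -1" using D0' fD0 irr by (intro cyc_weight_cycle) auto
  define A where "A = {C. C \<subseteq> D \<and> f ` C = C \<and> C \<inter> D0 = {}}"
  define B where "B = {C. C \<subseteq> D \<and> f ` C = C \<and> D0 \<subseteq> C}"
  have "C \<inter> D0 = {} \<or> D0 \<subseteq> C" if "f ` C = C" for C
    using irr[of "C \<inter> D0"] that D0' by blast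
  then have AB: "{C. C \<subseteq> D \<and> f ` C = C} = A \<union> B" unfolding A_def B_def by auto
  have disj: "A \<inter> B = {}" using D0' unfolding A_def B_def by auto
  have finAB: "finite A" "finite B" using assms unfolding A_def B_def
    by (auto intro: finite_subset[of _ "Pow D"])
  have "(\<Sum>C\<in>B. cyc_weight f C) = (\<Sum>C\<in>A. cyc_weight f (C \<union> D0))"
  proof (rule sum.reindex_bij_witness[of _ "\<lambda>C. C \<union> D0" "\<lambda>C. C - D0"])
    fix C assume C: "C \<in> B"
    then have "inj_on f C" using fin[of C] unfolding B_def by (intro eq_card_imp_inj_on) auto
    then have "f ` (C - D0) = f ` C - f ` D0" using C unfolding B_def
      by (intro inj_on_image_set_diff) auto
    then have "f ` (C - D0) = C - D0" using C fD0 unfolding B_def by simp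
    then show "C - D0 \<in> A" using C unfolding A_def B_def by auto
    show "C - D0 \<union> D0 = C" using C unfolding B_def by auto
    then show "cyc_weight f (C - D0 \<union> D0) = cyc_weight f C" by simp
  qed (use D0' fD0 in \<open>auto simp: A_def B_def image_Un\<close>)
  also have "\<dots> = (\<Sum>C\<in>A. - cyc_weight f C)"
  proof (rule sum.cong)
    fix C assume C: "C \<in> A"
    then have "finite C" "C \<inter> D0 = {}" "f ` C = C" using fin unfolding A_def by auto
    then have "cyc_weight f (C \<union> D0) = cyc_weight f C * cyc_weight f D0"
      using D0' fD0 unfolding cyc_weight_def
      by (simp add: sign_on_disjoint_Un card_Un_disjoint power_add)
    then show "cyc_weight f (C \<union> D0) = - cyc_weight f C" using w0 by simp
  qed simp
  finally show ?thesis using False AB disj finAB by (simp add: sum.union_disjoint sum_negf)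
qed

subsection \<open>Bijections inducing a forest\<close>

text \<open>Extensionality ensures that each bijection of \<open>S\<close> onto \<open>T\<close> is
  counted once.\<close>

definition bijs :: "'a set \<Rightarrow> 'b set \<Rightarrow> ('a \<Rightarrow> 'b) set" where
  "bijs S T = {\<sigma> \<in> extensional S. bij_betw \<sigma> S T}"

lemma finite_bijs: "finite S \<Longrightarrow> finite T \<Longrightarrow> finite (bijs S T)"
  by (rule finite_subset[OF _ finite_PiE[of S "\<lambda>_. T"]])
    (auto simp: bijs_def PiE_def bij_betw_def)

lemma bijs_empty [simp]: "bijs {} {} = {\<lambda>_. undefined}"
  by (auto simp: bijs_def bij_betw_def)

lemma bijs_singleton: "card (bijs {x} {y}) = 1"
proof -
  have "bijs {x} {y} = {\<lambda>z\<in>{x}. y}"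
    by (auto simp: bijs_def bij_betw_def extensional_def fun_eq_iff)
  then show ?thesis by simp
qed

text \<open>\<open>A1\<close> and \<open>A2\<close> see only the values on \<open>S1\<close> and on
  \<open>S2\<close>, so restricting to both halves is a bijection onto pairs, with gluing as its
  inverse.\<close>

lemma card_bijs_split:
  assumes S: "S1 \<inter> S2 = {}" and T: "T1 \<inter> T2 = {}"
    and A1: "\<And>\<sigma> \<sigma>'. (\<And>x. x \<in> S1 \<Longrightarrow> \<sigma> x = \<sigma>' x) \<Longrightarrow> A1 \<sigma> = A1 \<sigma>'"
    and A2: "\<And>\<sigma> \<sigma>'. (\<And>x. x \<in> S2 \<Longrightarrow> \<sigma> x = \<sigma>' x) \<Longrightarrow> A2 \<sigma> = A2 \<sigma>'"
  shows "card {\<sigma> \<in> bijs (S1 \<union> S2) (T1 \<union> T2). \<sigma> ` S1 = T1 \<and> A1 \<sigma> \<and> A2 \<sigma>} =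
    card {\<sigma> \<in> bijs S1 T1. A1 \<sigma>} * card {\<sigma> \<in> bijs S2 T2. A2 \<sigma>}"
proof -
  let ?L = "{\<sigma> \<in> bijs (S1 \<union> S2) (T1 \<union> T2). \<sigma> ` S1 = T1 \<and> A1 \<sigma> \<and> A2 \<sigma>}"
  let ?R = "{\<sigma> \<in> bijs S1 T1. A1 \<sigma>} \<times> {\<sigma> \<in> bijs S2 T2. A2 \<sigma>}"
  let ?f = "\<lambda>\<sigma>. (restrict \<sigma> S1, restrict \<sigma> S2)"
  let ?g = "\<lambda>(a, b) x. if x \<in> S1 then a x else b x"
  have "bij_betw ?f ?L ?R"
  proof (rule bij_betw_byWitness[of _ ?g])
    show "\<forall>\<sigma>\<in>?L. ?g (?f \<sigma>) = \<sigma>"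
      by (auto simp: fun_eq_iff bijs_def extensional_def)
    show "\<forall>z\<in>?R. ?f (?g z) = z"
      using S by (auto simp: fun_eq_iff bijs_def extensional_def restrict_def)
    show "?f ` ?L \<subseteq> ?R"
    proof
      fix z assume "z \<in> ?f ` ?L"
      then obtain \<sigma> where \<sigma>: "\<sigma> \<in> ?L" "z = ?f \<sigma>" by blast
      have b: "bij_betw \<sigma> (S1 \<union> S2) (T1 \<union> T2)" "\<sigma> ` S1 = T1" using \<sigma>(1) by (auto simp: bijs_def)
      have b1: "bij_betw \<sigma> S1 T1" using b by (auto simp: bij_betw_def inj_on_Un)
      have "\<sigma> ` S1 \<inter> \<sigma> ` S2 = {}"
        using inj_on_image_Int[of \<sigma> "S1 \<union> S2" S1 S2] b(1) S by (simp add: bij_betw_def)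
      moreover have "\<sigma> ` S1 \<union> \<sigma> ` S2 = T1 \<union> T2" using b(1) by (simp add: bij_betw_def image_Un)
      ultimately have "\<sigma> ` S2 = T2" using b(2) T by blast
      then have b2: "bij_betw \<sigma> S2 T2" using b by (auto simp: bij_betw_def inj_on_Un)
      have "A1 (restrict \<sigma> S1)" "A2 (restrict \<sigma> S2)"
        using A1[of "restrict \<sigma> S1" \<sigma>] A2[of "restrict \<sigma> S2" \<sigma>] \<sigma>(1) by auto
      then show "z \<in> ?R" using \<sigma>(2) b1 b2 by (simp add: bijs_def)
    qed
    show "?g ` ?R \<subseteq> ?L"
    proof
      fix \<sigma> assume "\<sigma> \<in> ?g ` ?R"
      then obtain a b where ab: "a \<in> bijs S1 T1" "A1 a" "b \<in> bijs S2 T2" "A2 b"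
        and \<sigma>: "\<sigma> = (\<lambda>x. if x \<in> S1 then a x else b x)" by auto
      have s1: "\<sigma> x = a x" if "x \<in> S1" for x using that \<sigma> by simp
      have s2: "\<sigma> x = b x" if "x \<in> S2" for x using that \<sigma> S by auto
      have b1: "bij_betw \<sigma> S1 T1" using ab(1) s1 bij_betw_cong[of S1 \<sigma> a] by (auto simp: bijs_def)
      have b2: "bij_betw \<sigma> S2 T2" using ab(3) s2 bij_betw_cong[of S2 \<sigma> b] by (auto simp: bijs_def)
      have "\<sigma> \<in> extensional (S1 \<union> S2)" using ab \<sigma> by (auto simp: bijs_def extensional_def)
      moreover have "\<sigma> ` S1 = T1" using b1 by (simp add: bij_betw_def)
      moreover have "A1 \<sigma>" "A2 \<sigma>" using A1[of \<sigma> a] A2[of \<sigma> b] s1 s2 ab by auto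
      ultimately show "\<sigma> \<in> ?L" using bij_betw_combine[OF b1 b2 T] by (simp add: bijs_def)
    qed
  qed
  then show ?thesis by (simp add: bij_betw_same_card card_cartesian_product)
qed

lemma card_eq_sum_fibres:
  assumes "finite A" "finite T" "g ` A \<subseteq> T"
  shows "card A = (\<Sum>v\<in>T. card {a \<in> A. g a = v})"
  using sum.group[OF assms, of "\<lambda>_. 1::nat"] by simp

lemma card_bijs_value:
  assumes "x \<in> S" "v \<in> T"
    and "\<And>\<sigma> \<sigma>'. (\<And>y. y \<in> S - {x} \<Longrightarrow> \<sigma> y = \<sigma>' y) \<Longrightarrow> A \<sigma> = A \<sigma>'"
  shows "card {\<sigma> \<in> bijs S T. \<sigma> x = v \<and> A \<sigma>} = card {\<sigma> \<in> bijs (S - {x}) (T - {v}). A \<sigma>}"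
proof -
  have e: "{x} \<union> (S - {x}) = S" "{v} \<union> (T - {v}) = T" using assms by auto
  have "card {\<sigma> \<in> bijs ({x} \<union> (S - {x})) ({v} \<union> (T - {v})). \<sigma> ` {x} = {v} \<and> True \<and> A \<sigma>} =
      card {\<sigma> \<in> bijs {x} {v}. True} * card {\<sigma> \<in> bijs (S - {x}) (T - {v}). A \<sigma>}"
    by (rule card_bijs_split) (auto intro!: assms(3))
  then show ?thesis unfolding e by (simp add: bijs_singleton)
qed

lemma card_bijs:
  assumes "finite S" "finite T" "card S = card T"
  shows "card (bijs S T) = fact (card S)"
  using assms
proof (induction S arbitrary: T rule: finite_induct)
  case empty
  then show ?case by simp
next
  case (insert x S)
  have "card (bijs (insert x S) T) = (\<Sum>v\<in>T. card {\<sigma> \<in> bijs (insert x S) T. \<sigma> x = v})"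
    using insert by (intro card_eq_sum_fibres finite_bijs) (auto simp: bijs_def bij_betw_def)
  also have "\<dots> = (\<Sum>v\<in>T. fact (card S))"
  proof (rule sum.cong)
    fix v assume v: "v \<in> T"
    have "card {\<sigma> \<in> bijs (insert x S) T. \<sigma> x = v} = card (bijs S (T - {v}))"
      using card_bijs_value[of x "insert x S" v T "\<lambda>_. True"] v insert by simp
    moreover have "card T = Suc (card S)" using insert by simp
    ultimately show "card {\<sigma> \<in> bijs (insert x S) T. \<sigma> x = v} = fact (card S)"
      using insert.IH[of "T - {v}"] insert.prems(1) v by simp
  qed simp
  finally show ?case using insert.hyps insert.prems(2)[symmetric] by simp
qed

text \<open>Expose the image of one special vertex at a time; its component is then merged with the
  component it is attached to.\<close>

lemma card_acyclic_bijs: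
  assumes "finite Q" "finite S" "finite T" "card S = card T" "S \<noteq> {}"
    and "inj_on e Q" "e ` Q \<subseteq> S"
  shows "card {\<sigma> \<in> bijs S T. acyclic_on Q (\<lambda>p. h (\<sigma> (e p)))} =
    card {v \<in> T. h v \<notin> Q} * fact (card S - 1)"
  using assms
proof (induction Q arbitrary: S T h rule: finite_induct)
  case empty
  then have "card S > 0" by auto
  then show ?case using empty by (simp add: card_bijs fact_reduce)
next
  case (insert p Q)
  let ?A = "{\<sigma> \<in> bijs S T. acyclic_on (insert p Q) (\<lambda>q. h (\<sigma> (e q)))}"
  define rt where "rt v w = (if w = p then h v else w)" for v w
  let ?B = "\<lambda>v. {\<sigma> \<in> bijs (S - {e p}) (T - {v}). acyclic_on Q (\<lambda>q. rt v (h (\<sigma> (e q))))}"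
  have ep: "e p \<in> S" using insert by auto
  have eq: "e q \<in> S - {e p}" if "q \<in> Q" for q
  proof -
    have "e q \<noteq> e p" using insert.prems(5) insert.hyps(2) that by (auto simp: inj_on_def)
    then show ?thesis using insert.prems(6) that by auto
  qed
  \<comment> \<open>The image of \<open>e p\<close> either closes a loop at \<open>p\<close> or
    attaches \<open>p\<close> to another component; in the latter case every arrival at
    \<open>p\<close> may be read as an arrival there.\<close>
  have acy: "acyclic_on (insert p Q) (\<lambda>q. h (\<sigma> (e q))) \<longleftrightarrow>
      h (\<sigma> (e p)) \<noteq> p \<and> acyclic_on Q (\<lambda>q. rt (\<sigma> (e p)) (h (\<sigma> (e q))))" for \<sigma>
  proof (cases "h (\<sigma> (e p)) = p")
    case True
    then have "\<not> acyclic_on {p} (\<lambda>q. h (\<sigma> (e q)))" by (simp add: acyclic_on_singleton)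
    then have "\<not> acyclic_on (insert p Q) (\<lambda>q. h (\<sigma> (e q)))"
      using acyclic_on_subset[of "insert p Q" _ "{p}"] by blast
    then show ?thesis using True by simp
  next
    case False
    have "acyclic_on ({p} \<union> Q) (\<lambda>q. h (\<sigma> (e q))) \<longleftrightarrow> acyclic_on Q (rt (\<sigma> (e p)) \<circ> (\<lambda>q. h (\<sigma> (e q))))"
      by (rule acyclic_on_contract) (use False insert.hyps in \<open>auto simp: rt_def acyclic_on_singleton\<close>)
    then show ?thesis using False by (simp add: o_def)
  qed
  define W where "W = card {v \<in> T. h v \<notin> insert p Q}"
  define wp where "wp = card {v \<in> T. h v = p}"
  define m where "m = card {v \<in> T. h v \<in> Q}"
  have T: "T = {v \<in> T. h v \<notin> insert p Q} \<union> {v \<in> T. h v = p} \<union> {v \<in> T. h v \<in> Q}" by auto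
  have cT: "card T = W + wp + m" unfolding W_def wp_def m_def using insert.hyps insert.prems(2)
    by (subst T, subst card_Un_disjoint; (subst card_Un_disjoint)?) auto
  have "card ?A = (\<Sum>v\<in>T. card {\<sigma> \<in> ?A. \<sigma> (e p) = v})"
  proof (rule card_eq_sum_fibres)
    show "finite ?A" using insert.prems by (simp add: finite_bijs)
    show "(\<lambda>\<sigma>. \<sigma> (e p)) ` ?A \<subseteq> T" using ep by (auto simp: bijs_def bij_betw_def)
  qed (use insert.prems in simp)
  also have "\<dots> = (\<Sum>v\<in>T. if h v = p then 0 else card (?B v))"
  proof (rule sum.cong)
    fix v assume v: "v \<in> T"
    have "{\<sigma> \<in> ?A. \<sigma> (e p) = v} = (if h v = p then {} else
        {\<sigma> \<in> bijs S T. \<sigma> (e p) = v \<and> acyclic_on Q (\<lambda>q. rt v (h (\<sigma> (e q))))})"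
      unfolding acy by auto
    moreover have "card {\<sigma> \<in> bijs S T. \<sigma> (e p) = v \<and> acyclic_on Q (\<lambda>q. rt v (h (\<sigma> (e q))))} = card (?B v)"
      using ep v
    proof (rule card_bijs_value)
      fix \<sigma> \<sigma>' :: "'b \<Rightarrow> 'c"
      assume "\<And>y. y \<in> S - {e p} \<Longrightarrow> \<sigma> y = \<sigma>' y"
      then show "acyclic_on Q (\<lambda>q. rt v (h (\<sigma> (e q)))) = acyclic_on Q (\<lambda>q. rt v (h (\<sigma>' (e q))))"
        using eq by (intro acyclic_on_cong) simp
    qed
    ultimately show "card {\<sigma> \<in> ?A. \<sigma> (e p) = v} = (if h v = p then 0 else card (?B v))" by simp
  qed simp
  also have "\<dots> = W * fact (card S - 1)"
  proof (cases "S = {e p}")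
    case True
    then have Q: "Q = {}" using eq by auto
    obtain v where v: "T = {v}" using True insert.prems by (metis card_1_singletonE is_singletonI is_singleton_altdef)
    have "{w \<in> T. h w \<notin> insert p Q} = (if h v = p then {} else {v})" using Q v by auto
    then show ?thesis using True Q v by (simp add: W_def)
  next
    case False
    define f where "f = (fact (card S - 2) :: nat)"
    have S': "S - {e p} \<noteq> {}" "card (S - {e p}) = card S - 1" using False ep insert.prems by auto
    have "card S \<noteq> 1" using False ep by (metis card_1_singletonE singletonD)
    moreover have "card S \<noteq> 0" using ep insert.prems by auto
    ultimately have cS: "card S \<ge> 2" by simp
    have B: "card (?B v) = card {w \<in> T - {v}. rt v (h w) \<notin> Q} * f" if "v \<in> T" for v
      using insert.IH[of "S - {e p}" "T - {v}" "\<lambda>w. rt v (h w)"] insert.prems S' eq that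
      by (auto simp: f_def inj_on_insert numeral_2_eq_2)
    \<comment> \<open>If \<open>h v\<close> lies outside \<open>insert p Q\<close>, the
      \<open>wp\<close> targets at \<open>p\<close> become exits and \<open>v\<close> itself is used
      up, leaving \<open>W + wp - 1\<close> exits. If \<open>h v\<close> lies in \<open>Q\<close>,
      the targets at \<open>p\<close> join that component and the \<open>W\<close> exits
      remain.\<close>
    have sub: "(if h v = p then 0 else card (?B v)) =
       (if h v \<notin> insert p Q then (W + wp - 1) * f else 0) + (if h v \<in> Q then W * f else 0)"
      if v: "v \<in> T" for v
    proof -
      consider "h v = p" | "h v \<notin> insert p Q" | "h v \<in> Q" "h v \<noteq> p" by blast
      then show ?thesis
      proof cases
        case 1 then show ?thesis using insert.hyps by simp
      next
        case 2
        have "{w \<in> T - {v}. rt v (h w) \<notin> Q} =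
            ({w \<in> T. h w \<notin> insert p Q} \<union> {w \<in> T. h w = p}) - {v}"
          using 2 by (auto simp: rt_def)
        moreover have "card ({w \<in> T. h w \<notin> insert p Q} \<union> {w \<in> T. h w = p}) = W + wp"
          unfolding W_def wp_def using insert.prems by (intro card_Un_disjoint) auto
        ultimately have "card {w \<in> T - {v}. rt v (h w) \<notin> Q} = W + wp - 1" using 2 v by simp
        then show ?thesis using 2 B[OF v] by simp
      next
        case 3
        have "{w \<in> T - {v}. rt v (h w) \<notin> Q} = {w \<in> T. h w \<notin> insert p Q}"
          using 3 by (auto simp: rt_def)
        then show ?thesis using 3 B[OF v] by (simp add: W_def)
      qed
    qed
    have "(\<Sum>v\<in>T. if h v = p then 0 else card (?B v)) =
        (\<Sum>v\<in>T. (if h v \<notin> insert p Q then (W + wp - 1) * f else 0) + (if h v \<in> Q then W * f else 0))"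
      by (rule sum.cong[OF refl sub])
    also have "\<dots> = W * ((W + wp - 1) * f) + m * (W * f)"
      using insert.prems(2) by (simp only: sum.distrib sum.inter_filter[symmetric])
        (simp add: W_def m_def)
    \<comment> \<open>The two cases add up because \<open>W + wp + m = card T = card S\<close>. For
      \<open>W = 0\<close> both sides vanish, whatever the truncated difference is.\<close>
    also have "\<dots> = W * ((card S - 1) * f)"
      using cT insert.prems(3) by (cases W) (simp_all add: algebra_simps)
    also have "(card S - 1) * f = fact (card S - 1)"
      unfolding f_def using cS fact_reduce[of "card S - 1", where ?'a = nat] by (simp add: numeral_2_eq_2)
    finally show ?thesis .
  qed
  finally show ?case by (simp add: W_def)
qed

subsection \<open>Vertices arranged in columns\<close>

lemma card_subsets_avoiding:
  assumes "finite K" "C \<subseteq> K"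
  shows "card {S. S \<subseteq> K \<and> card S = r \<and> C \<inter> S = {}} = (card K - card C) choose r"
proof -
  have "{S. S \<subseteq> K \<and> card S = r \<and> C \<inter> S = {}} = {S. S \<subseteq> K - C \<and> card S = r}" by auto
  then show ?thesis using assms n_subsets[of "K - C" r] finite_subset[OF assms(2,1)]
    by (simp add: card_Diff_subset)
qed

text \<open>Pascal's rule turns differences of the binomials into binomials with lower entry
  \<open>r - 1\<close>; the bound \<open>n \<le> k\<close> keeps the subtractions in the upper entry
  exact.\<close>

lemma sum_by_parts_choose:
  fixes a :: "nat \<Rightarrow> int"
  assumes "n \<le> k" "r \<ge> 1"
  shows "int (k choose r) * a 0 - (\<Sum>m<n. (a m - a (Suc m)) * int ((k - Suc m) choose r)) =
    (\<Sum>m<n. a m * int ((k - Suc m) choose (r - 1))) + a n * int ((k - n) choose r)"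
  using assms(1)
proof (induction n)
  case 0
  then show ?case by simp
next
  case (Suc n)
  then have "k - n = Suc (k - Suc n)" by simp
  then have "(k - n) choose r = ((k - Suc n) choose (r - 1)) + ((k - Suc n) choose r)"
    using assms(2) by (cases r) simp_all
  then show ?case using Suc by (simp add: algebra_simps)
qed

text \<open>\<open>V\<close> stands for the vertices of either row, \<open>l c\<close> for the last vertex of column \<open>c\<close>, \<open>Q\<close> for the
  columns of \<open>P\<close> unmarked in row 1, and \<open>rt c\<close> for the root of the arrow tree containing \<open>c\<close>.\<close>

locale vertex_columns =
  fixes V :: "'v set" and col :: "'v \<Rightarrow> 'c" and l :: "'c \<Rightarrow> 'v"
    and Q :: "'c set" and rt :: "'c \<Rightarrow> 'c"
  assumes finite_V: "finite V"
    and l_in: "c \<in> col ` V \<Longrightarrow> l c \<in> V"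
    and col_l: "c \<in> col ` V \<Longrightarrow> col (l c) = c"
    and Q_sub: "Q \<subseteq> col ` V"
    and rt_Q: "p \<in> Q \<Longrightarrow> rt p = p"
begin

definition root_of :: "'v \<Rightarrow> 'c" where "root_of v = rt (col v)"

definition column_map :: "('v \<Rightarrow> 'v) \<Rightarrow> 'c \<Rightarrow> 'c" where
  "column_map \<sigma> j = col (inv_into V \<sigma> (l j))"

definition forest_bijs :: "('v \<Rightarrow> 'v) set" where
  "forest_bijs = {\<sigma> \<in> bijs V V. acyclic_on Q (\<lambda>p. root_of (\<sigma> (l p)))}"

lemma finite_Q: "finite Q"
  using Q_sub finite_V finite_subset by blast

lemma finite_forest_bijs: "finite forest_bijs"
  using finite_bijs[OF finite_V finite_V] by (simp add: forest_bijs_def)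

lemma inj_l: "C \<subseteq> col ` V \<Longrightarrow> inj_on l C"
  by (rule inj_on_inverseI[of _ col]) (use col_l in blast)

lemma col_l_image: "C \<subseteq> col ` V \<Longrightarrow> col ` l ` C = C"
  using col_l by (force simp: image_image)

lemma l_image_sub: "C \<subseteq> col ` V \<Longrightarrow> l ` C \<subseteq> V"
  using l_in by blast

lemma root_of_l: "p \<in> Q \<Longrightarrow> root_of (l p) = p"
  using col_l Q_sub rt_Q by (auto simp: root_of_def)

lemma forest_bijs_bij: "\<sigma> \<in> forest_bijs \<Longrightarrow> bij_betw \<sigma> V V"
  by (simp add: forest_bijs_def bijs_def)

text \<open>A union \<open>C\<close> of cycles of \<open>column_map \<sigma>\<close> is recorded by
  the row-1 vertices matched with the last vertices of \<open>C\<close>. With such a set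
  \<open>U\<close> held fixed while \<sigma> varies, exchanging the images of two members of
  \<open>U\<close> changes neither \<open>U\<close> nor its image.\<close>

definition transversals :: "('v \<Rightarrow> 'v) \<Rightarrow> 'v set set" where
  "transversals \<sigma> = {U. U \<subseteq> V \<and> inj_on col U \<and> \<sigma> ` U = l ` col ` U}"

lemma column_map_image: "column_map \<sigma> ` C = col ` inv_into V \<sigma> ` l ` C"
  by (simp add: column_map_def image_image)

lemma sum_closed_columns:
  assumes \<sigma>: "bij_betw \<sigma> V V"
  shows "(\<Sum>C | C \<subseteq> col ` V \<and> column_map \<sigma> ` C = C. f C) = (\<Sum>U\<in>transversals \<sigma>. f (col ` U))"
proof (rule sum.reindex_bij_witness[of _ "\<lambda>U. col ` U" "\<lambda>C. inv_into V \<sigma> ` l ` C"])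
  have im: "\<sigma> ` V = V" using \<sigma> by (simp add: bij_betw_def)
  fix C assume "C \<in> {C. C \<subseteq> col ` V \<and> column_map \<sigma> ` C = C}"
  then have C: "C \<subseteq> col ` V" "column_map \<sigma> ` C = C" by auto
  have lC: "l ` C \<subseteq> V" using l_image_sub C by auto
  let ?U = "inv_into V \<sigma> ` l ` C"
  show cU: "col ` ?U = C" using C(2) by (simp only: column_map_image)
  have UV: "?U \<subseteq> V" using lC im by (metis bij_betw_def bij_betw_inv_into image_mono \<sigma>)
  have fC: "finite C" using C finite_V finite_subset by blast
  \<comment> \<open>\<open>?U\<close> has at most as many elements as \<open>C\<close> and projects
    onto \<open>C\<close>, so it meets each column of \<open>C\<close> exactly once.\<close>
  have "card C \<le> card ?U" using cU fC by (metis card_image_le finite_imageI)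
  moreover have "card ?U \<le> card C" using fC by (metis card_image_le finite_imageI order_trans)
  ultimately have "inj_on col ?U" using cU fC by (intro eq_card_imp_inj_on) auto
  moreover have "\<sigma> ` ?U = l ` C" using lC im by (intro image_inv_into_cancel) auto
  ultimately show "?U \<in> transversals \<sigma>" using UV cU by (simp add: transversals_def)
  show "f (col ` ?U) = f C" using cU by simp
next
  have inj: "inj_on \<sigma> V" using \<sigma> by (simp add: bij_betw_def)
  fix U assume "U \<in> transversals \<sigma>"
  then have U: "U \<subseteq> V" "inj_on col U" "\<sigma> ` U = l ` col ` U" by (auto simp: transversals_def)
  show *: "inv_into V \<sigma> ` l ` col ` U = U" using inj U by (metis inv_into_image_cancel)
  then have "column_map \<sigma> ` col ` U = col ` U" by (simp only: column_map_image)
  then show "col ` U \<in> {C. C \<subseteq> col ` V \<and> column_map \<sigma> ` C = C}" using U by auto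
qed

lemma column_map_bij_betw:
  assumes \<sigma>: "bij_betw \<sigma> V V" and U: "U \<in> transversals \<sigma>"
  shows "bij_betw (column_map \<sigma>) (col ` U) (col ` U)"
proof -
  have U': "U \<subseteq> V" "\<sigma> ` U = l ` col ` U" using U by (auto simp: transversals_def)
  then have "inv_into V \<sigma> ` l ` col ` U = U"
    using \<sigma> unfolding bij_betw_def by (metis inv_into_image_cancel)
  then have "column_map \<sigma> ` col ` U = col ` U" by (simp only: column_map_image)
  moreover have "finite (col ` U)" using finite_subset[OF U'(1) finite_V] by simp
  ultimately show ?thesis using finite_surj_inj[of "col ` U" "column_map \<sigma>"] by (simp add: bij_betw_def)
qed

text \<open>Exchanging the images of two vertices that are not the last vertex of a cell in \<open>Q\<close> preserves
  membership in \<open>forest_bijs\<close> and reverses the sign, so only transversals with at most one such vertex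
  contribute.\<close>

lemma sum_weight_two_free:
  assumes U: "U \<subseteq> V" "inj_on col U" and ab: "a \<in> U - l ` Q" "b \<in> U - l ` Q" "a \<noteq> b"
  shows "(\<Sum>\<sigma> | \<sigma> \<in> forest_bijs \<and> U \<in> transversals \<sigma>. cyc_weight (column_map \<sigma>) (col ` U)) = 0"
proof -
  let ?t = "transpose a b"
  let ?A = "{\<sigma>. \<sigma> \<in> forest_bijs \<and> U \<in> transversals \<sigma>}"
  have abV: "a \<in> V" "b \<in> V" using ab U by auto
  have tt: "\<sigma> \<circ> ?t \<circ> ?t = \<sigma>" for \<sigma> :: "'v \<Rightarrow> 'v" by (simp add: comp_assoc)
  have tU: "?t ` U = U" "?t ` V = V" using ab abV by (auto intro!: permutes_image permutes_swap_id)
  have tin: "?t z \<in> U" if "z \<in> U" for z using tU that by blast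
  have bt: "bij_betw ?t V V" using abV by (intro permutes_imp_bij permutes_swap_id)
  have closed: "\<sigma> \<circ> ?t \<in> ?A" if "\<sigma> \<in> ?A" for \<sigma>
  proof -
    have \<sigma>: "\<sigma> \<in> extensional V" "bij_betw \<sigma> V V" "acyclic_on Q (\<lambda>p. root_of (\<sigma> (l p)))" "\<sigma> ` U = l ` col ` U"
      using that by (auto simp: forest_bijs_def bijs_def transversals_def)
    have "(\<sigma> \<circ> ?t) ` U = l ` col ` U" using tU \<sigma> by (metis image_comp)
    moreover have "\<sigma> \<circ> ?t \<in> extensional V"
      using \<sigma>(1) abV by (auto simp: extensional_def transpose_def)
    moreover have "bij_betw (\<sigma> \<circ> ?t) V V" using bij_betw_trans[OF bt \<sigma>(2)] .
    moreover have "acyclic_on Q (\<lambda>p. root_of ((\<sigma> \<circ> ?t) (l p)))"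
    proof -
      have "?t (l p) = l p" if "p \<in> Q" for p
        using that ab by (intro transpose_apply_other) auto
      then show ?thesis using \<sigma>(3) acyclic_on_cong[of Q "\<lambda>p. root_of ((\<sigma> \<circ> ?t) (l p))" "\<lambda>p. root_of (\<sigma> (l p))"] by simp
    qed
    ultimately show ?thesis using U by (simp add: forest_bijs_def bijs_def transversals_def)
  qed
  have weight: "cyc_weight (column_map (\<sigma> \<circ> ?t)) (col ` U) = - cyc_weight (column_map \<sigma>) (col ` U)"
    if "\<sigma> \<in> ?A" for \<sigma>
  proof -
    let ?t' = "transpose (col a) (col b)"
    have \<sigma>: "bij_betw \<sigma> V V" "U \<in> transversals \<sigma>" "\<sigma> ` U = l ` col ` U"
      using that forest_bijs_bij by (auto simp: transversals_def)
    have ct: "col (?t z) = ?t' (col z)" if "z \<in> U" for z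
      using that U(2) ab by (auto simp: transpose_def inj_on_eq_iff)
    \<comment> \<open>The vertex matched with \<open>l j\<close> moves by \<open>?t\<close>, so
      \<open>column_map\<close> is followed by the transposition of two columns, which are distinct
      because \<open>col\<close> is injective on \<open>U\<close>.\<close>
    have "column_map (\<sigma> \<circ> ?t) j = (?t' \<circ> column_map \<sigma>) j" if j: "j \<in> col ` U" for j
    proof -
      obtain z where z: "z \<in> U" "l j = \<sigma> z" using \<sigma>(3) j by (metis imageE imageI)
      have i1: "inv_into V \<sigma> (l j) = z"
        unfolding z(2) using \<sigma>(1) z U by (intro inv_into_f_f) (auto simp: bij_betw_def)
      have "inv_into V (\<sigma> \<circ> ?t) ((\<sigma> \<circ> ?t) (?t z)) = ?t z"
        using bij_betw_trans[OF bt \<sigma>(1)] tin[OF z(1)] U by (intro inv_into_f_f) (auto simp: bij_betw_def)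
      then have "inv_into V (\<sigma> \<circ> ?t) (l j) = ?t z" by (simp add: z(2))
      then show ?thesis using ct[OF z(1)] i1 by (simp add: column_map_def)
    qed
    then have "sign_on (col ` U) (column_map (\<sigma> \<circ> ?t)) = sign_on (col ` U) (?t' \<circ> column_map \<sigma>)"
      by (intro sign_on_cong) auto
    also have "\<dots> = sign_on (col ` U) ?t' * sign_on (col ` U) (column_map \<sigma>)"
    proof (rule sign_on_compose)
      show "bij_betw ?t' (col ` U) (col ` U)"
        using ab by (intro permutes_imp_bij permutes_swap_id) auto
      show "finite (col ` U)" using finite_subset[OF U(1) finite_V] by simp
    qed (rule column_map_bij_betw[OF \<sigma>(1,2)])
    also have "sign_on (col ` U) ?t' = -1"
      using ab U(2) by (intro sign_on_transpose) (auto simp: inj_on_eq_iff)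
    finally have "sign_on (col ` U) (column_map (\<sigma> \<circ> ?t)) = -1 * sign_on (col ` U) (column_map \<sigma>)" .
    then show ?thesis unfolding cyc_weight_def by (simp only: mult_minus1 mult_minus_right)
  qed
  have "(\<Sum>\<sigma>\<in>?A. cyc_weight (column_map \<sigma>) (col ` U)) = (\<Sum>\<sigma>\<in>?A. - cyc_weight (column_map \<sigma>) (col ` U))"
    by (rule sum.reindex_bij_witness[of _ "\<lambda>\<sigma>. \<sigma> \<circ> ?t" "\<lambda>\<sigma>. \<sigma> \<circ> ?t"])
      (use tt closed weight in simp_all)
  then show ?thesis by (simp add: sum_negf)
qed

text \<open>If all vertices of \<open>U\<close> are last vertices of a set \<open>C\<close> of
  columns in \<open>Q\<close>, then \<sigma> permutes them, and \<open>C\<close> is closed under the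
  map of row 1.\<close>

lemma no_transversal_in_Q:
  assumes "U \<subseteq> l ` Q" "U \<noteq> {}" "\<sigma> \<in> forest_bijs" "U \<in> transversals \<sigma>"
  shows False
proof -
  obtain C where C: "C \<subseteq> Q" "U = l ` C" using assms(1) by (auto simp: subset_image_iff)
  have cU: "col ` U = C" using C Q_sub col_l_image by auto
  have "C = {}"
  proof (rule acyclic_onD)
    show "acyclic_on Q (\<lambda>p. root_of (\<sigma> (l p)))" using assms by (simp add: forest_bijs_def)
    fix p assume "p \<in> C"
    then have "\<sigma> (l p) \<in> l ` C" using assms(4) C cU by (auto simp: transversals_def)
    then show "root_of (\<sigma> (l p)) \<in> C" using C(1) root_of_l by auto
  qed (rule C)
  then show False using C assms by simp
qed

text \<open>If the predecessor under \<open>column_map \<sigma>\<close> of a column in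
  \<open>C\<close> is again in \<open>C\<close>, it is the value of the row-1 map at that column. An
  invariant set inside \<open>C\<close> would thus be closed under the row-1 map. So every nonempty
  invariant set contains \<open>col v\<close>, and its complement, invariant and contained in
  \<open>C\<close>, is empty: there is just one cycle.\<close>

lemma weight_one_free:
  assumes \<sigma>: "\<sigma> \<in> forest_bijs" and C: "C \<subseteq> Q" "col v \<notin> C" and v: "v \<in> V"
    and U: "insert v (l ` C) \<in> transversals \<sigma>"
  shows "cyc_weight (column_map \<sigma>) (insert (col v) C) = -1"
proof -
  let ?D = "insert (col v) C"
  have colU: "col ` insert v (l ` C) = ?D" using C Q_sub col_l_image[of C] by simp
  have U': "\<sigma> ` insert v (l ` C) = l ` ?D"
  proof -
    have "\<sigma> ` insert v (l ` C) = l ` col ` insert v (l ` C)"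
      using U by (simp only: transversals_def mem_Collect_eq)
    then show ?thesis by (simp only: colU)
  qed
  have bij: "bij_betw (column_map \<sigma>) ?D ?D" using column_map_bij_betw[OF forest_bijs_bij[OF \<sigma>] U] colU by simp
  have inj: "inj_on \<sigma> V" using forest_bijs_bij[OF \<sigma>] by (simp add: bij_betw_def)
  have lC: "l ` C \<subseteq> V" using C Q_sub l_image_sub by auto
  have acycC: "acyclic_on C (\<lambda>p. root_of (\<sigma> (l p)))"
    using \<sigma> C acyclic_on_subset by (auto simp: forest_bijs_def)
  have pre: "\<exists>j\<in>?D. \<sigma> (l p) = l j \<and> column_map \<sigma> j = p" if "p \<in> C" for p
  proof -
    have "l p \<in> insert v (l ` C)" using that by simp
    then have "\<sigma> (l p) \<in> l ` ?D" unfolding U'[symmetric] by (rule imageI)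
    then obtain j where j: "j \<in> ?D" "\<sigma> (l p) = l j" by (rule imageE)
    have "inv_into V \<sigma> (l j) = l p"
      unfolding j(2)[symmetric] using inj lC that by (intro inv_into_f_f) auto
    then have "column_map \<sigma> j = p" using that C Q_sub col_l by (auto simp: column_map_def)
    then show ?thesis using j by auto
  qed
  have injD: "inj_on (column_map \<sigma>) ?D" using bij by (simp add: bij_betw_def)
  have fin: "finite ?D" using C finite_Q finite_subset by auto
  have avoid: "E = {}" if E: "E \<subseteq> C" "column_map \<sigma> ` E = E" for E
  proof (rule acyclic_onD[OF acycC])
    fix p assume p: "p \<in> E"
    obtain j where j: "j \<in> ?D" "\<sigma> (l p) = l j" "column_map \<sigma> j = p" using pre p E by auto
    have "p \<in> column_map \<sigma> ` E" using p E(2) by simp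
    then obtain e where e: "e \<in> E" "p = column_map \<sigma> e" by (rule imageE)
    then have "j = e" using inj_onD[OF injD, of j e] j E(1) by auto
    then have "j \<in> E" using e by simp
    moreover have "root_of (l j) = j" using \<open>j \<in> E\<close> E C root_of_l by auto
    ultimately show "root_of (\<sigma> (l p)) \<in> E" using j by simp
  qed (rule E)
  show ?thesis
  proof (rule cyc_weight_cycle)
    show "column_map \<sigma> ` ?D = ?D" using bij by (simp add: bij_betw_def)
    fix E assume E: "E \<subseteq> ?D" "E \<noteq> {}" "column_map \<sigma> ` E \<subseteq> E"
    have "finite E" using fin E finite_subset by blast
    moreover have "inj_on (column_map \<sigma>) E" using injD E inj_on_subset by blast
    ultimately have eqE: "column_map \<sigma> ` E = E" using E(3) by (simp add: endo_inj_surj)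
    have "col v \<in> E"
      using avoid[OF _ eqE] E by blast
    then have "?D - E \<subseteq> C" by auto
    moreover have "column_map \<sigma> ` (?D - E) = column_map \<sigma> ` ?D - column_map \<sigma> ` E"
      using injD E by (intro inj_on_image_set_diff) auto
    then have "column_map \<sigma> ` (?D - E) = ?D - E" using eqE bij by (simp add: bij_betw_def)
    ultimately have "?D - E = {}" by (rule avoid)
    then show "E = ?D" using E by auto
  qed (use fin in auto)
qed

section \<open>Reduction to a single free vertex\<close>

definition num_one_free :: "'v \<Rightarrow> 'c set \<Rightarrow> nat" where
  "num_one_free v C = card {\<sigma> \<in> forest_bijs. \<sigma> ` insert v (l ` C) = l ` insert (col v) C}"

text \<open>The empty transversal gives the first term. A pair \<open>(v, C)\<close> has weight -1
  and occupies \<open>Suc (card C)\<close> columns, because the column of \<open>v\<close> comes on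
  top of \<open>C\<close>. Later \<open>b\<close> will be the number of sets \<open>S\<close>
  avoiding a given number of columns.\<close>

lemma sum_weights_by_free_vertex:
  fixes b :: "nat \<Rightarrow> int"
  defines "I \<equiv> {(v, C). v \<in> V - l ` Q \<and> C \<subseteq> Q \<and> col v \<notin> C}"
  shows "(\<Sum>\<sigma>\<in>forest_bijs. \<Sum>C | C \<subseteq> col ` V \<and> column_map \<sigma> ` C = C. b (card C) * cyc_weight (column_map \<sigma>) C) =
    b 0 * int (card forest_bijs) - (\<Sum>(v, C)\<in>I. b (Suc (card C)) * int (num_one_free v C))"
proof -
  define G where "G U = (\<Sum>\<sigma> | \<sigma> \<in> forest_bijs \<and> U \<in> transversals \<sigma>. cyc_weight (column_map \<sigma>) (col ` U))" for U
  let ?u = "\<lambda>(v, C). insert v (l ` C)"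
  have fin_I: "finite I"
    by (rule finite_subset[of _ "V \<times> Pow Q"]) (auto simp: I_def finite_V finite_Q)
  have trans_eq: "transversals \<sigma> = {U \<in> Pow V. U \<in> transversals \<sigma>}" for \<sigma>
    by (auto simp: transversals_def)
  have "(\<Sum>\<sigma>\<in>forest_bijs. \<Sum>C | C \<subseteq> col ` V \<and> column_map \<sigma> ` C = C. b (card C) * cyc_weight (column_map \<sigma>) C) =
      (\<Sum>\<sigma>\<in>forest_bijs. \<Sum>U\<in>transversals \<sigma>. b (card (col ` U)) * cyc_weight (column_map \<sigma>) (col ` U))"
    by (rule sum.cong[OF refl], rule sum_closed_columns, rule forest_bijs_bij)
  also have "\<dots> = (\<Sum>\<sigma>\<in>forest_bijs. \<Sum>U\<in>{U \<in> Pow V. U \<in> transversals \<sigma>}.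
      b (card (col ` U)) * cyc_weight (column_map \<sigma>) (col ` U))"
    by (simp only: trans_eq[symmetric])
  \<comment> \<open>With \<open>U\<close> outermost, the inner sum over \<sigma> is one to which the
    exchange of two images applies.\<close>
  also have "\<dots> = (\<Sum>U\<in>Pow V. \<Sum>\<sigma>\<in>{\<sigma> \<in> forest_bijs. U \<in> transversals \<sigma>}.
      b (card (col ` U)) * cyc_weight (column_map \<sigma>) (col ` U))"
    by (rule sum.swap_restrict) (use finite_forest_bijs finite_V in auto)
  also have "\<dots> = (\<Sum>U\<in>Pow V. b (card (col ` U)) * G U)"
    by (simp only: G_def sum_distrib_left)
  also have "\<dots> = (\<Sum>U\<in>insert {} (?u ` I). b (card (col ` U)) * G U)"
  proof (rule sum.mono_neutral_right)
    show "insert {} (?u ` I) \<subseteq> Pow V" using l_in Q_sub by (auto simp: I_def)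
    show "\<forall>U\<in>Pow V - insert {} (?u ` I). b (card (col ` U)) * G U = 0"
    proof
      fix U assume U: "U \<in> Pow V - insert {} (?u ` I)"
      have "G U = 0"
      proof (cases "inj_on col U")
        case False
        then have "{\<sigma>. \<sigma> \<in> forest_bijs \<and> U \<in> transversals \<sigma>} = {}" by (simp add: transversals_def)
        then show ?thesis unfolding G_def by (simp only: sum.empty)
      next
        case inj: True
        show ?thesis
        proof (cases "U \<subseteq> l ` Q")
          case True
          then have "{\<sigma>. \<sigma> \<in> forest_bijs \<and> U \<in> transversals \<sigma>} = {}" using no_transversal_in_Q U by blast
          then show ?thesis unfolding G_def by (simp only: sum.empty)
        next
          case False
          then obtain v where v: "v \<in> U - l ` Q" by blast
          show ?thesis
          proof (cases "U - {v} \<subseteq> l ` Q")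
            case True
            then obtain C where C: "C \<subseteq> Q" "U - {v} = l ` C" by (auto simp: subset_image_iff)
            have Uv: "U = insert v (l ` C)" using v C(2) by auto
            \<comment> \<open>Otherwise \<open>l (col v)\<close> is a member of \<open>U\<close> in
              the same column as \<open>v\<close>, hence equal to \<open>v\<close>, and
              \<open>v\<close> would not be free.\<close>
            have "col v \<notin> C"
            proof
              assume c: "col v \<in> C"
              then have "col (l (col v)) = col v" using C(1) Q_sub col_l by auto
              moreover have "l (col v) \<in> U" using c Uv by auto
              ultimately have "l (col v) = v" using inj v by (auto dest: inj_onD)
              then show False using v c C(1) by (metis DiffD2 imageI subsetD)
            qed
            then have "(v, C) \<in> I" using v U C(1) by (auto simp: I_def)
            then have "U \<in> ?u ` I" using Uv by (intro image_eqI[of _ _ "(v, C)"]) auto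
            then show ?thesis using U by simp
          next
            case False
            then obtain a where "a \<in> U - l ` Q" "a \<noteq> v" by blast
            then show ?thesis unfolding G_def using U inj v
              by (intro sum_weight_two_free[of U a v]) auto
          qed
        qed
      qed
      then show "b (card (col ` U)) * G U = 0" by simp
    qed
  qed (use finite_V in simp)
  also have "\<dots> = b 0 * G {} + (\<Sum>U\<in>?u ` I. b (card (col ` U)) * G U)"
    using fin_I by (subst sum.insert) auto
  also have "(\<Sum>U\<in>?u ` I. b (card (col ` U)) * G U) =
      (\<Sum>z\<in>I. b (card (col ` ?u z)) * G (?u z))"
  proof (rule sum.reindex_cong)
    show "inj_on ?u I"
    proof (rule inj_onI, clarify)
      fix v C v' C'
      assume I: "(v, C) \<in> I" "(v', C') \<in> I" and eq: "insert v (l ` C) = insert v' (l ` C')"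
      have "insert v (l ` C) - l ` Q = {v}" "insert v' (l ` C') - l ` Q = {v'}"
        using I by (auto simp: I_def)
      then have vv: "v = v'" using eq by simp
      have "l ` C = insert v (l ` C) - {v}" using I by (auto simp: I_def)
      also have "\<dots> = insert v' (l ` C') - {v'}" using eq vv by simp
      also have "\<dots> = l ` C'" using I by (auto simp: I_def)
      finally have "l ` C = l ` C'" .
      then have "col ` l ` C = col ` l ` C'" by simp
      then show "v = v' \<and> C = C'" using vv I Q_sub col_l_image[of C] col_l_image[of C']
        by (auto simp: I_def)
    qed
  qed auto
  also have "\<dots> = (\<Sum>z\<in>I. - (case z of (v, C) \<Rightarrow> b (Suc (card C)) * int (num_one_free v C)))"
  proof (rule sum.cong[OF refl])
    fix z assume "z \<in> I"
    then obtain v C where z: "z = (v, C)" "v \<in> V - l ` Q" "C \<subseteq> Q" "col v \<notin> C" by (auto simp: I_def)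
    have CV: "C \<subseteq> col ` V" using z Q_sub by auto
    have colU: "col ` insert v (l ` C) = insert (col v) C" using col_l_image[OF CV] by simp
    have "inj_on col (l ` C)" using CV col_l by (auto intro!: inj_onI simp: subset_iff)
    moreover have "col v \<notin> col ` (l ` C - {v})" using col_l_image[OF CV] z(4) by blast
    ultimately have "inj_on col (insert v (l ` C))" by simp
    moreover have "insert v (l ` C) \<subseteq> V" using z(2) l_image_sub[OF CV] by auto
    ultimately have T: "insert v (l ` C) \<in> transversals \<sigma> \<longleftrightarrow>
        \<sigma> ` insert v (l ` C) = l ` insert (col v) C" for \<sigma>
      unfolding transversals_def by (simp only: colU mem_Collect_eq simp_thms)
    have "G (insert v (l ` C)) = (\<Sum>\<sigma> | \<sigma> \<in> forest_bijs \<and> insert v (l ` C) \<in> transversals \<sigma>. -1)"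
      unfolding G_def colU by (rule sum.cong[OF refl]) (use weight_one_free z in blast)
    also have "\<dots> = - int (num_one_free v C)" unfolding T by (simp add: num_one_free_def)
    finally have "G (?u z) = - int (num_one_free v C)" using z(1) by simp
    moreover have "card (col ` ?u z) = Suc (card C)"
      using colU z finite_subset[OF z(3) finite_Q] by simp
    ultimately show "b (card (col ` ?u z)) * G (?u z) = - (case z of (v, C) \<Rightarrow> b (Suc (card C)) * int (num_one_free v C))"
      using z(1) by simp
  qed
  also have "G {} = int (card forest_bijs)"
    by (simp add: G_def transversals_def cyc_weight_def sign_on_def restrict_id_def)
  finally show ?thesis by (simp add: sum_negf)
qed

section \<open>Counting the bijections with one free vertex\<close>

definition root_weight :: nat where "root_weight = card {w \<in> V. root_of w \<notin> Q}"
definition free_weight :: nat where "free_weight = card (V - l ` Q)"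

lemma card_free: "free_weight = card V - card Q" "card Q \<le> card V"
proof -
  have "card (l ` Q) = card Q" using inj_l[OF Q_sub] by (rule card_image)
  moreover have sub: "l ` Q \<subseteq> V" using l_image_sub[OF Q_sub] .
  ultimately show "free_weight = card V - card Q" unfolding free_weight_def
    using finite_subset[OF sub finite_V] by (simp add: card_Diff_subset)
  show "card Q \<le> card V" using card_mono[OF finite_V sub] \<open>card (l ` Q) = card Q\<close> by simp
qed

lemma root_weight_eq: "root_weight = card {w \<in> V - l ` Q. root_of w \<notin> Q}"
proof -
  have "{w \<in> V. root_of w \<notin> Q} = {w \<in> V - l ` Q. root_of w \<notin> Q}" using root_of_l by auto
  then show ?thesis by (simp add: root_weight_def)
qed

lemma root_weight_le: "root_weight \<le> free_weight"
  unfolding root_weight_eq free_weight_def using finite_V by (intro card_mono) auto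

lemma card_forest_bijs: "V \<noteq> {} \<Longrightarrow> card forest_bijs = root_weight * fact (card V - 1)"
  unfolding forest_bijs_def root_weight_def
  using card_acyclic_bijs[OF finite_Q finite_V finite_V refl _ inj_l[OF Q_sub] l_image_sub[OF Q_sub]] by simp

text \<open>\<open>l (col v)\<close> has the same root as \<open>v\<close>. If this root lies in
  \<open>C\<close>, the row-1 map sends \<open>C\<close> into itself, so only free vertices with
  root outside \<open>C\<close> matter.\<close>

lemma num_one_free_eq_0:
  assumes "root_of v \<in> C" "C \<subseteq> Q" "v \<in> V" "col v \<notin> C"
  shows "num_one_free v C = 0"
proof -
  have "\<sigma> ` insert v (l ` C) \<noteq> l ` insert (col v) C" if \<sigma>: "\<sigma> \<in> forest_bijs" for \<sigma>
  proof
    assume eq: "\<sigma> ` insert v (l ` C) = l ` insert (col v) C"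
    have "C = {}"
    proof (rule acyclic_onD)
      show "acyclic_on Q (\<lambda>p. root_of (\<sigma> (l p)))" using \<sigma> by (simp add: forest_bijs_def)
      fix p assume "p \<in> C"
      then have "\<sigma> (l p) \<in> l ` insert (col v) C" using eq[symmetric] by simp
      then show "root_of (\<sigma> (l p)) \<in> C"
        using assms root_of_l col_l[of "col v"] by (auto simp: root_of_def)
    qed (rule assms)
    then show False using assms by simp
  qed
  then have "{\<sigma> \<in> forest_bijs. \<sigma> ` insert v (l ` C) = l ` insert (col v) C} = {}" by blast
  then show ?thesis unfolding num_one_free_def by (simp only: card.empty)
qed

text \<open>The prescribed vertices and the others are matched separately. Among the prescribed
  targets \<open>l (col v)\<close> is the only one with root outside \<open>C\<close>, so the forest
  count there is \<open>1 * fact (card C)\<close> and all of \<open>C\<close> ends up attached to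
  \<open>root_of v\<close>. For the other vertices \<open>C\<close> is contracted to that
  root.\<close>

lemma num_one_free_split:
  assumes C: "C \<subseteq> Q" and v: "v \<in> V - l ` Q" and hv: "root_of v \<notin> C"
  defines "V1 \<equiv> V - l ` insert (col v) C"
  shows "num_one_free v C = fact (card C) * card {\<sigma> \<in> bijs (V - insert v (l ` C)) V1.
    acyclic_on (Q - C) (\<lambda>p. (\<lambda>x. if x \<in> C then root_of v else x) (root_of (\<sigma> (l p))))}"
proof -
  define U where "U = insert v (l ` C)"
  define T where "T = l ` insert (col v) C"
  let ?rt = "\<lambda>x. if x \<in> C then root_of v else x"
  have CV: "C \<subseteq> col ` V" using C Q_sub by auto
  have cv: "col v \<notin> C" using hv C rt_Q by (auto simp: root_of_def)
  have fC: "finite C" using C finite_Q finite_subset by auto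
  have DV: "insert (col v) C \<subseteq> col ` V" using CV v by auto
  have UV: "U \<subseteq> V" "T \<subseteq> V" using v l_image_sub[OF CV] l_image_sub[OF DV] by (auto simp: U_def T_def)
  have cU: "card U = Suc (card C)" using v C fC card_image[OF inj_l[OF CV]] by (auto simp: U_def card_insert_if)
  have cT: "card T = Suc (card C)" unfolding T_def using card_image[OF inj_l[OF DV]] cv fC by simp
  have fU: "finite U" "finite T" using UV finite_V finite_subset by auto
  have hlv: "root_of (l (col v)) = root_of v" using v col_l by (simp add: root_of_def)
  have acy: "acyclic_on Q (\<lambda>p. root_of (\<sigma> (l p))) \<longleftrightarrow>
      acyclic_on C (\<lambda>p. root_of (\<sigma> (l p))) \<and> acyclic_on (Q - C) (\<lambda>p. ?rt (root_of (\<sigma> (l p))))" if "\<sigma> ` U = T" for \<sigma>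
  proof (cases "acyclic_on C (\<lambda>p. root_of (\<sigma> (l p)))")
    case True
    have "acyclic_on (C \<union> (Q - C)) (\<lambda>p. root_of (\<sigma> (l p))) \<longleftrightarrow> acyclic_on (Q - C) (?rt \<circ> (\<lambda>p. root_of (\<sigma> (l p))))"
    proof (rule acyclic_on_contract[OF True])
      fix x assume x: "x \<in> C"
      then have "\<sigma> (l x) \<in> T" using that by (auto simp: U_def)
      then have "root_of (\<sigma> (l x)) \<in> insert (root_of v) C" using root_of_l C hlv by (auto simp: T_def)
      then show "?rt (root_of (\<sigma> (l x))) = ?rt x" using x hv by auto
    qed (use hv in auto)
    then show ?thesis using True C by (simp add: o_def Un_absorb1)
  next
    case False
    then show ?thesis using acyclic_on_subset[OF _ C] by blast
  qed
  have "num_one_free v C = card {\<sigma> \<in> bijs (U \<union> (V - U)) (T \<union> (V - T)). \<sigma> ` U = T \<and>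
      acyclic_on C (\<lambda>p. root_of (\<sigma> (l p))) \<and> acyclic_on (Q - C) (\<lambda>p. ?rt (root_of (\<sigma> (l p))))}"
  proof -
    have "U \<union> (V - U) = V" "T \<union> (V - T) = V" using UV by auto
    moreover have "{\<sigma> \<in> forest_bijs. \<sigma> ` U = T} = {\<sigma> \<in> bijs V V. \<sigma> ` U = T \<and>
      acyclic_on C (\<lambda>p. root_of (\<sigma> (l p))) \<and> acyclic_on (Q - C) (\<lambda>p. ?rt (root_of (\<sigma> (l p))))}"
      unfolding forest_bijs_def using acy by blast
    ultimately show ?thesis unfolding num_one_free_def U_def[symmetric] T_def[symmetric] by simp
  qed
  also have "\<dots> = card {\<sigma> \<in> bijs U T. acyclic_on C (\<lambda>p. root_of (\<sigma> (l p)))} *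
      card {\<sigma> \<in> bijs (V - U) (V - T). acyclic_on (Q - C) (\<lambda>p. ?rt (root_of (\<sigma> (l p))))}"
  proof (rule card_bijs_split)
    fix \<sigma> \<sigma>' :: "'v \<Rightarrow> 'v" assume "\<And>x. x \<in> U \<Longrightarrow> \<sigma> x = \<sigma>' x"
    then show "acyclic_on C (\<lambda>p. root_of (\<sigma> (l p))) = acyclic_on C (\<lambda>p. root_of (\<sigma>' (l p)))"
      by (intro acyclic_on_cong) (simp add: U_def)
  next
    fix \<sigma> \<sigma>' :: "'v \<Rightarrow> 'v" assume eq: "\<And>x. x \<in> V - U \<Longrightarrow> \<sigma> x = \<sigma>' x"
    have "\<sigma> (l p) = \<sigma>' (l p)" if "p \<in> Q - C" for p
    proof (rule eq)
      have "l p \<notin> l ` C" using that C inj_on_image_mem_iff[OF inj_l[OF Q_sub], of p C] by auto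
      then show "l p \<in> V - U" using that v l_image_sub[OF Q_sub] by (auto simp: U_def)
    qed
    then show "acyclic_on (Q - C) (\<lambda>p. ?rt (root_of (\<sigma> (l p)))) = acyclic_on (Q - C) (\<lambda>p. ?rt (root_of (\<sigma>' (l p))))"
      by (intro acyclic_on_cong) simp
  qed auto
  also have "card {\<sigma> \<in> bijs U T. acyclic_on C (\<lambda>p. root_of (\<sigma> (l p)))} = card {w \<in> T. root_of w \<notin> C} * fact (card U - 1)"
    by (rule card_acyclic_bijs[OF fC fU]) (use cU cT inj_l[OF CV] in \<open>auto simp: U_def\<close>)
  also have "{w \<in> T. root_of w \<notin> C} = {l (col v)}" using hlv hv root_of_l C by (auto simp: T_def)
  finally show ?thesis using cU by (simp add: U_def T_def V1_def)
qed

text \<open>The number in front of the factorial counts the remaining targets that lead out of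
  \<open>Q - C\<close> once \<open>C\<close> hangs on \<open>root_of v\<close>. If that root is in
  \<open>Q\<close>, no new exit opens. Otherwise the free vertices with root in \<open>C\<close>
  become exits, while the exit \<open>l (col v)\<close> is used up. When no vertex remains, the
  empty bijection counts once.\<close>

lemma num_one_free_eq:
  assumes C: "C \<subseteq> Q" and v: "v \<in> V - l ` Q" and hv: "root_of v \<notin> C"
  shows "num_one_free v C = fact (card C) * (if Suc (card C) < card V then
    (if root_of v \<in> Q then root_weight else root_weight + card {w \<in> V - l ` Q. root_of w \<in> C} - 1) * fact (card V - card C - 2) else 1)"
proof -
  define V0 where "V0 = V - insert v (l ` C)"
  define V1 where "V1 = V - l ` insert (col v) C"
  let ?rt = "\<lambda>x. if x \<in> C then root_of v else x"
  have CV: "C \<subseteq> col ` V" using C Q_sub by auto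
  have cv: "col v \<notin> C" using hv C rt_Q by (auto simp: root_of_def)
  have fC: "finite C" using C finite_Q finite_subset by auto
  have DV: "insert (col v) C \<subseteq> col ` V" using CV v by auto
  have UV: "insert v (l ` C) \<subseteq> V" "l ` insert (col v) C \<subseteq> V" using v l_image_sub[OF CV] l_image_sub[OF DV] by auto
  have hlv: "root_of (l (col v)) = root_of v" using v col_l by (simp add: root_of_def)
  have cU: "card (insert v (l ` C)) = Suc (card C)"
    using v C fC card_image[OF inj_l[OF CV]] by (auto simp: card_insert_if)
  have cT: "card (l ` insert (col v) C) = Suc (card C)"
    using card_image[OF inj_l[OF DV]] cv fC by simp
  have c0: "card V0 = card V - Suc (card C)"
    unfolding V0_def using UV fC cU by (subst card_Diff_subset) auto
  have c1: "card V1 = card V - Suc (card C)"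
    unfolding V1_def using UV fC cT by (subst card_Diff_subset) auto
  have fin: "finite V0" "finite V1" using finite_V by (auto simp: V0_def V1_def)
  have QC: "l ` (Q - C) \<subseteq> V0"
  proof -
    have "l p \<notin> l ` C" if "p \<in> Q - C" for p
      using that C inj_on_image_mem_iff[OF inj_l[OF Q_sub], of p C] by auto
    then show ?thesis using v l_image_sub[OF Q_sub] by (auto simp: V0_def)
  qed
  have count: "card {w \<in> V1. ?rt (root_of w) \<notin> Q - C} =
      (if root_of v \<in> Q then root_weight else root_weight + card {w \<in> V - l ` Q. root_of w \<in> C} - 1)"
  proof (cases "root_of v \<in> Q")
    case True
    then have "{w \<in> V1. ?rt (root_of w) \<notin> Q - C} = {w \<in> V. root_of w \<notin> Q}"
      using hv hlv root_of_l C by (auto simp: V1_def)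
    then show ?thesis using True by (simp add: root_weight_def)
  next
    case False
    have "{w \<in> V1. ?rt (root_of w) \<notin> Q - C} =
        ({w \<in> V. root_of w \<notin> Q} - {l (col v)}) \<union> {w \<in> V - l ` Q. root_of w \<in> C}"
      using False hv hlv root_of_l C by (auto simp: V1_def)
    also have "card \<dots> = card ({w \<in> V. root_of w \<notin> Q} - {l (col v)}) + card {w \<in> V - l ` Q. root_of w \<in> C}"
      using finite_V C by (intro card_Un_disjoint) auto
    moreover have "l (col v) \<in> {w \<in> V. root_of w \<notin> Q}" using False hlv v l_in by auto
    then have "card ({w \<in> V. root_of w \<notin> Q} - {l (col v)}) = root_weight - 1" "root_weight > 0"
      using finite_V by (auto simp: root_weight_def card_gt_0_iff)
    ultimately show ?thesis using False by simp
  qed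
  have NC: "num_one_free v C = fact (card C) * card {\<sigma> \<in> bijs V0 V1. acyclic_on (Q - C) (\<lambda>p. ?rt (root_of (\<sigma> (l p))))}"
    using num_one_free_split[OF C v hv] by (simp only: V0_def V1_def)
  show ?thesis
  proof (cases "Suc (card C) < card V")
    case True
    then have "V0 \<noteq> {}" using c0 by auto
    moreover have "inj_on l (Q - C)" by (rule inj_on_subset[OF inj_l[OF Q_sub]]) auto
    ultimately have "card {\<sigma> \<in> bijs V0 V1. acyclic_on (Q - C) (\<lambda>p. ?rt (root_of (\<sigma> (l p))))} =
        card {w \<in> V1. ?rt (root_of w) \<notin> Q - C} * fact (card V0 - 1)"
      using card_acyclic_bijs[of "Q - C" V0 V1 l "\<lambda>w. ?rt (root_of w)"] fin c0 c1 QC finite_Q by simp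
    then show ?thesis using True NC count c0 by (simp add: numeral_2_eq_2)
  next
    case False
    then have "V0 = {}" "V1 = {}" using c0 c1 fin by auto
    moreover have "Q - C = {}" using QC \<open>V0 = {}\<close> by auto
    ultimately have "{\<sigma> \<in> bijs V0 V1. acyclic_on (Q - C) (\<lambda>p. ?rt (root_of (\<sigma> (l p))))} = {\<lambda>_. undefined}"
      by (simp only: bijs_empty acyclic_on_empty) simp
    then have "card {\<sigma> \<in> bijs V0 V1. acyclic_on (Q - C) (\<lambda>p. ?rt (root_of (\<sigma> (l p))))} = card {\<lambda>_::'v. undefined :: 'v}"
      by (rule arg_cong)
    then show ?thesis using False unfolding NC by simp
  qed
qed

text \<open>Let \<open>y\<close> and \<open>z\<close> be the numbers of free vertices with root in
  \<open>C\<close> and in \<open>Q - C\<close>. Then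
  \<open>root_weight * (root_weight + y - 1) + z * root_weight\<close> equals
  \<open>root_weight * (free_weight - 1)\<close>, so nothing but the size of \<open>C\<close>
  survives.\<close>

lemma sum_num_one_free:
  assumes C: "C \<subseteq> Q"
  shows "(\<Sum>v\<in>{v \<in> V - l ` Q. root_of v \<notin> C}. num_one_free v C) =
    fact (card C) * root_weight * (if Suc (card C) < card V then (free_weight - 1) * fact (card V - card C - 2) else 1)"
proof (cases "Suc (card C) < card V")
  case True
  define f where "f = (fact (card V - card C - 2) :: nat)"
  define y where "y = card {w \<in> V - l ` Q. root_of w \<in> C}"
  define z where "z = card {w \<in> V - l ` Q. root_of w \<in> Q - C}"
  have fin: "finite {w \<in> V - l ` Q. P w}" for P using finite_V by simp
  have "V - l ` Q = {w \<in> V - l ` Q. root_of w \<notin> Q} \<union> {w \<in> V - l ` Q. root_of w \<in> C} \<union> {w \<in> V - l ` Q. root_of w \<in> Q - C}"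
    using C by blast
  then have "free_weight = card ({w \<in> V - l ` Q. root_of w \<notin> Q} \<union> {w \<in> V - l ` Q. root_of w \<in> C} \<union> {w \<in> V - l ` Q. root_of w \<in> Q - C})"
    unfolding free_weight_def by (rule arg_cong)
  also have "\<dots> = card ({w \<in> V - l ` Q. root_of w \<notin> Q} \<union> {w \<in> V - l ` Q. root_of w \<in> C}) + z"
    unfolding z_def using fin C by (intro card_Un_disjoint) auto
  also have "card ({w \<in> V - l ` Q. root_of w \<notin> Q} \<union> {w \<in> V - l ` Q. root_of w \<in> C}) = root_weight + y"
    unfolding root_weight_eq y_def using fin C by (intro card_Un_disjoint) auto
  finally have split: "free_weight = root_weight + y + z" .
  have "{v \<in> V - l ` Q. root_of v \<notin> C} = {w \<in> V - l ` Q. root_of w \<notin> Q} \<union> {w \<in> V - l ` Q. root_of w \<in> Q - C}"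
    using C by blast
  then have "(\<Sum>v\<in>{v \<in> V - l ` Q. root_of v \<notin> C}. num_one_free v C) =
      (\<Sum>v\<in>{w \<in> V - l ` Q. root_of w \<notin> Q} \<union> {w \<in> V - l ` Q. root_of w \<in> Q - C}. num_one_free v C)" by (rule sum.cong) simp
  also have "\<dots> = (\<Sum>v\<in>{w \<in> V - l ` Q. root_of w \<notin> Q}. num_one_free v C) + (\<Sum>v\<in>{w \<in> V - l ` Q. root_of w \<in> Q - C}. num_one_free v C)"
    using fin by (intro sum.union_disjoint) auto
  also have "(\<Sum>v\<in>{w \<in> V - l ` Q. root_of w \<notin> Q}. num_one_free v C) =
      (\<Sum>v\<in>{w \<in> V - l ` Q. root_of w \<notin> Q}. fact (card C) * ((root_weight + y - 1) * f))"
  proof (intro sum.cong refl)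
    fix v assume "v \<in> {w \<in> V - l ` Q. root_of w \<notin> Q}"
    then show "num_one_free v C = fact (card C) * ((root_weight + y - 1) * f)"
      using num_one_free_eq[OF C, of v] True C by (simp add: y_def f_def subset_iff split del: if_split) blast
  qed
  also have "\<dots> = root_weight * (fact (card C) * ((root_weight + y - 1) * f))" by (simp add: root_weight_eq)
  also have "(\<Sum>v\<in>{w \<in> V - l ` Q. root_of w \<in> Q - C}. num_one_free v C) =
      (\<Sum>v\<in>{w \<in> V - l ` Q. root_of w \<in> Q - C}. fact (card C) * (root_weight * f))"
    using num_one_free_eq[OF C] True C by (intro sum.cong refl) (auto simp: f_def)
  also have "\<dots> = z * (fact (card C) * (root_weight * f))" by (simp add: z_def)
  also have "root_weight * (fact (card C) * ((root_weight + y - 1) * f)) + z * (fact (card C) * (root_weight * f)) =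
      fact (card C) * root_weight * ((free_weight - 1) * f)"
    unfolding split by (cases root_weight) (simp_all add: algebra_simps)
  finally show ?thesis using True by (simp add: f_def)
next
  case False
  have le: "card C \<le> card Q" using C finite_Q by (rule card_mono[rotated])
  \<comment> \<open>If a free vertex exists, then \<open>card Q < card V \<le> Suc (card C)\<close>
    forces \<open>C = Q\<close>; if none exists, both sets are empty.\<close>
  have "{v \<in> V - l ` Q. root_of v \<notin> C} = {v \<in> V - l ` Q. root_of v \<notin> Q}"
  proof (cases "free_weight = 0")
    case True
    then have "V - l ` Q = {}" using finite_V by (simp add: free_weight_def)
    then show ?thesis by auto
  next
    case nonzero: False
    then have "card C = card Q" using False le card_free by linarith
    then have "C = Q" using C finite_Q by (simp add: card_subset_eq)
    then show ?thesis by simp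
  qed
  moreover have "(\<Sum>v\<in>{v \<in> V - l ` Q. root_of v \<notin> C}. num_one_free v C) = (\<Sum>v\<in>{v \<in> V - l ` Q. root_of v \<notin> C}. fact (card C))"
    using num_one_free_eq[OF C] False by (intro sum.cong refl) simp
  ultimately show ?thesis using False by (simp add: root_weight_eq)
qed

text \<open>The falling factorial of \<open>card Q\<close> with \<open>m\<close> factors times (card
  V - m - 1)!, where the factorial of a negative number is read as 0.\<close>

definition coeff :: "nat \<Rightarrow> nat" where
  "coeff m = (card Q choose m) * fact m * (if m < card V then fact (card V - Suc m) else 0)"

text \<open>With q = card Q and s = card V, this is (s-q-1) (s-m-2)! = (s-m-1)! - (q-m) (s-m-2)!,
  where q - m is the next factor of the falling factorial. A positive \<open>root_weight\<close>
  gives q < s, so the second branch of the conditional occurs only for m = q = s - 1.\<close>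

lemma coeff_diff:
  assumes m: "m \<le> card Q" and pos: "root_weight > 0"
  shows "int ((card Q choose m) * fact m *
      (if Suc m < card V then (free_weight - 1) * fact (card V - m - 2) else 1)) = int (coeff m) - int (coeff (Suc m))"
proof -
  define q where "q = card Q"
  define s where "s = card V"
  have fw: "free_weight = s - q" "q < s" using pos root_weight_le card_free by (auto simp: q_def s_def)
  have step: "(q choose Suc m) * fact (Suc m) = (q choose m) * fact m * (q - m)"
  proof -
    have "(q choose Suc m) * Suc m = (q choose m) * (q - m)"
      using binomial_absorb_comp[of q m] binomial_absorption[of m q]
      by (metis binomial_absorption binomial_absorb_comp mult.commute diff_Suc_1 times_binomial_minus1_eq)
    then have "(q choose Suc m) * Suc m * fact m = (q choose m) * (q - m) * fact m" by simp
    then show ?thesis by (simp only: fact_Suc of_nat_id mult_ac)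
  qed
  show ?thesis
  proof (cases "Suc m < s")
    case True
    then obtain t where t: "s = m + 2 + t" using less_imp_add_positive by (metis Suc_leI add_2_eq_Suc' add_Suc le_Suc_ex)
    have "(free_weight - 1) + (q - m) = Suc t" using fw m t by (simp add: q_def)
    then have "(free_weight - 1) * fact t + (q - m) * fact t = fact (Suc t)"
      by (simp only: flip: distrib_right) simp
    then have "int (free_weight - 1) * fact t + int (q - m) * fact t = (fact (Suc t) :: int)"
      by (metis of_nat_add of_nat_mult of_nat_fact)
    then have e: "int (free_weight - 1) * fact t = (fact (Suc t) :: int) - int (q - m) * fact t" by simp
    have e2: "int (coeff (Suc m)) = int ((q choose m) * fact m) * (int (q - m) * fact t)"
    proof -
      have "coeff (Suc m) = (q choose m) * fact m * (q - m) * fact t"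
        unfolding coeff_def q_def[symmetric] s_def[symmetric] step using t by simp
      then show ?thesis by (simp only: of_nat_mult of_nat_fact mult_ac)
    qed
    have e1: "int (coeff m) = int ((q choose m) * fact m) * fact (Suc t)"
    proof -
      have "s - Suc m = Suc t" "(m < s) = True" using t by simp_all
      then show ?thesis
        unfolding coeff_def q_def[symmetric] s_def[symmetric] by (simp only: if_True of_nat_mult of_nat_fact)
    qed
    have "int ((q choose m) * fact m * ((free_weight - 1) * fact (s - m - 2))) =
        int ((q choose m) * fact m) * (int (free_weight - 1) * fact t)" using t by simp
    then show ?thesis using True e1 e2 unfolding e q_def[symmetric] s_def[symmetric]
      by (simp add: right_diff_distrib)
  next
    case False
    then have "Suc m = s" "m = q" using fw m by (auto simp: q_def)
    then show ?thesis unfolding coeff_def q_def[symmetric] s_def[symmetric] by auto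
  qed
qed

text \<open>For a given \<sigma> and a union \<open>C\<close> of its cycles, exactly
  \<open>(card K - card C) choose r\<close> sets \<open>S\<close> avoid \<open>C\<close>, so the sum
  over \<open>S\<close> can be carried out before the one over \<sigma>. \<open>K\<close> includes
  the empty columns, which can be marked but lie on no cycle.\<close>

lemma sum_columns_marked:
  assumes K: "finite K" "col ` V \<subseteq> K" "card Q < card K" and r: "r \<ge> 1" and V: "V \<noteq> {}"
  shows "(\<Sum>S | S \<subseteq> K \<and> card S = r. card {\<sigma> \<in> forest_bijs. acyclic_on (col ` V - S) (column_map \<sigma>)}) =
    root_weight * (\<Sum>m\<le>card Q. coeff m * ((card K - Suc m) choose (r - 1)))"
proof -
  define k where "k = card K"
  define b where "b m = int ((k - m) choose r)" for m
  define I where "I = {(v, C). v \<in> V - l ` Q \<and> C \<subseteq> Q \<and> col v \<notin> C}"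
  let ?S = "{S. S \<subseteq> K \<and> card S = r}"
  let ?C = "\<lambda>\<sigma>. {C. C \<subseteq> col ` V \<and> column_map \<sigma> ` C = C}"
  have finV: "finite (col ` V)" using finite_V by simp
  have finS: "finite ?S" using K by simp
  have finC: "finite (?C \<sigma>)" for \<sigma> using finV by simp
  have "int (\<Sum>S\<in>?S. card {\<sigma> \<in> forest_bijs. acyclic_on (col ` V - S) (column_map \<sigma>)}) =
      (\<Sum>S\<in>?S. \<Sum>\<sigma>\<in>forest_bijs. if acyclic_on (col ` V - S) (column_map \<sigma>) then 1 else 0)"
    using finite_forest_bijs by (simp flip: sum.inter_filter)
  also have "\<dots> = (\<Sum>S\<in>?S. \<Sum>\<sigma>\<in>forest_bijs. \<Sum>C\<in>?C \<sigma>. if C \<inter> S = {} then cyc_weight (column_map \<sigma>) C else 0)"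
  proof (intro sum.cong refl)
    fix S \<sigma>
    have "(if acyclic_on (col ` V - S) (column_map \<sigma>) then 1 else 0) =
        (\<Sum>C | C \<subseteq> col ` V - S \<and> column_map \<sigma> ` C = C. cyc_weight (column_map \<sigma>) C)"
      by (rule acyclic_on_indicator) (use finV in simp)
    also have "\<dots> = (\<Sum>C | C \<in> ?C \<sigma> \<and> C \<inter> S = {}. cyc_weight (column_map \<sigma>) C)"
      by (rule sum.cong) auto
    also have "\<dots> = (\<Sum>C\<in>?C \<sigma>. if C \<inter> S = {} then cyc_weight (column_map \<sigma>) C else 0)"
      by (rule sum.inter_filter[OF finC])
    finally show "(if acyclic_on (col ` V - S) (column_map \<sigma>) then 1 else 0) =
        (\<Sum>C\<in>?C \<sigma>. if C \<inter> S = {} then cyc_weight (column_map \<sigma>) C else 0)" .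
  qed
  also have "\<dots> = (\<Sum>\<sigma>\<in>forest_bijs. \<Sum>S\<in>?S. \<Sum>C\<in>?C \<sigma>. if C \<inter> S = {} then cyc_weight (column_map \<sigma>) C else 0)"
    by (rule sum.swap)
  also have "\<dots> = (\<Sum>\<sigma>\<in>forest_bijs. \<Sum>C\<in>?C \<sigma>. \<Sum>S\<in>?S. if C \<inter> S = {} then cyc_weight (column_map \<sigma>) C else 0)"
    by (rule sum.cong[OF refl], rule sum.swap)
  also have "\<dots> = (\<Sum>\<sigma>\<in>forest_bijs. \<Sum>C\<in>?C \<sigma>. b (card C) * cyc_weight (column_map \<sigma>) C)"
  proof (intro sum.cong refl)
    fix \<sigma> C assume "C \<in> ?C \<sigma>"
    then have "C \<subseteq> K" using K by auto
    have "(\<Sum>S\<in>?S. if C \<inter> S = {} then cyc_weight (column_map \<sigma>) C else 0) =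
        (\<Sum>S\<in>{S \<in> ?S. C \<inter> S = {}}. cyc_weight (column_map \<sigma>) C)"
      by (rule sum.inter_filter[OF finS, symmetric])
    also have "{S \<in> ?S. C \<inter> S = {}} = {S. S \<subseteq> K \<and> card S = r \<and> C \<inter> S = {}}" by auto
    finally show "(\<Sum>S\<in>?S. if C \<inter> S = {} then cyc_weight (column_map \<sigma>) C else 0) = b (card C) * cyc_weight (column_map \<sigma>) C"
      using card_subsets_avoiding[OF K(1) \<open>C \<subseteq> K\<close>] by (simp add: b_def k_def)
  qed
  also have "\<dots> = b 0 * int (card forest_bijs) - (\<Sum>(v, C)\<in>I. b (Suc (card C)) * int (num_one_free v C))"
    unfolding I_def by (rule sum_weights_by_free_vertex)
  \<comment> \<open>Pairs with \<open>col v \<notin> C\<close> but \<open>root_of v \<in> C\<close>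
    contribute 0, and the counts by size of \<open>C\<close> need the condition on roots.\<close>
  also have "(\<Sum>(v, C)\<in>I. b (Suc (card C)) * int (num_one_free v C)) =
      (\<Sum>(C, v)\<in>Sigma (Pow Q) (\<lambda>C. {v \<in> V - l ` Q. root_of v \<notin> C}). b (Suc (card C)) * int (num_one_free v C))"
  proof -
    have "(\<Sum>(v, C)\<in>I. b (Suc (card C)) * int (num_one_free v C)) =
        (\<Sum>(v, C)\<in>{(v, C). v \<in> V - l ` Q \<and> C \<subseteq> Q \<and> root_of v \<notin> C}. b (Suc (card C)) * int (num_one_free v C))"
    proof (rule sum.mono_neutral_right)
      show "finite I" by (rule finite_subset[of _ "V \<times> Pow Q"]) (auto simp: I_def finite_V finite_Q)
      show "{(v, C). v \<in> V - l ` Q \<and> C \<subseteq> Q \<and> root_of v \<notin> C} \<subseteq> I"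
        using rt_Q by (auto simp: I_def root_of_def)
      show "\<forall>z\<in>I - {(v, C). v \<in> V - l ` Q \<and> C \<subseteq> Q \<and> root_of v \<notin> C}.
          (case z of (v, C) \<Rightarrow> b (Suc (card C)) * int (num_one_free v C)) = 0"
        using num_one_free_eq_0 by (auto simp: I_def)
    qed
    also have "\<dots> = (\<Sum>(C, v)\<in>Sigma (Pow Q) (\<lambda>C. {v \<in> V - l ` Q. root_of v \<notin> C}). b (Suc (card C)) * int (num_one_free v C))"
      by (rule sum.reindex_bij_witness[of _ "\<lambda>(C, v). (v, C)" "\<lambda>(v, C). (C, v)"]) auto
    finally show ?thesis .
  qed
  also have "\<dots> = (\<Sum>C\<in>Pow Q. \<Sum>v\<in>{v \<in> V - l ` Q. root_of v \<notin> C}. b (Suc (card C)) * int (num_one_free v C))"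
    using finite_V finite_Q by (intro sum.Sigma[symmetric]) auto
  also have "\<dots> = (\<Sum>C\<in>Pow Q. b (Suc (card C)) * int (fact (card C) * root_weight *
      (if Suc (card C) < card V then (free_weight - 1) * fact (card V - card C - 2) else 1)))"
    by (rule sum.cong[OF refl]) (simp only: Pow_iff sum_num_one_free[symmetric] sum_distrib_left of_nat_sum)
  also have "\<dots> = (\<Sum>m\<le>card Q. \<Sum>C\<in>{C \<in> Pow Q. card C = m}. b (Suc (card C)) * int (fact (card C) * root_weight *
      (if Suc (card C) < card V then (free_weight - 1) * fact (card V - card C - 2) else 1)))"
    by (rule sum.group[symmetric]) (use finite_Q in \<open>auto intro: card_mono\<close>)
  also have "\<dots> = (\<Sum>m\<le>card Q. int root_weight * ((int (coeff m) - int (coeff (Suc m))) * b (Suc m)))"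
  proof (rule sum.cong[OF refl])
    fix m assume "m \<in> {..card Q}"
    then have m: "m \<le> card Q" by simp
    define d where "d = (if Suc m < card V then (free_weight - 1) * fact (card V - m - 2) else 1)"
    have "(\<Sum>C\<in>{C \<in> Pow Q. card C = m}. b (Suc (card C)) * int (fact (card C) * root_weight *
        (if Suc (card C) < card V then (free_weight - 1) * fact (card V - card C - 2) else 1))) =
        (\<Sum>C\<in>{C \<in> Pow Q. card C = m}. b (Suc m) * int (fact m * root_weight * d))"
      by (rule sum.cong[OF refl]) (simp add: d_def)
    also have "\<dots> = int root_weight * (int ((card Q choose m) * fact m * d) * b (Suc m))"
      using n_subsets[OF finite_Q, of m] by simp
    also have "\<dots> = int root_weight * ((int (coeff m) - int (coeff (Suc m))) * b (Suc m))"
      using coeff_diff[OF m] unfolding d_def by (cases "root_weight = 0") auto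
    finally show "(\<Sum>C\<in>{C \<in> Pow Q. card C = m}. b (Suc (card C)) * int (fact (card C) * root_weight *
        (if Suc (card C) < card V then (free_weight - 1) * fact (card V - card C - 2) else 1))) =
        int root_weight * ((int (coeff m) - int (coeff (Suc m))) * b (Suc m))" .
  qed
  also have "b 0 * int (card forest_bijs) - \<dots> = int root_weight * (int (k choose r) * int (coeff 0) -
      (\<Sum>m<Suc (card Q). (int (coeff m) - int (coeff (Suc m))) * b (Suc m)))"
  proof -
    have "card V > 0" using V finite_V by auto
    then have "int (card forest_bijs) = int root_weight * int (coeff 0)" using card_forest_bijs[OF V] by (simp add: coeff_def)
    then show ?thesis unfolding lessThan_Suc_atMost
      by (simp add: b_def right_diff_distrib sum_distrib_left)
  qed
  \<comment> \<open>The boundary term at \<open>Suc (card Q)\<close> is 0, since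
    \<open>coeff\<close> contains the binomial \<open>card Q choose Suc (card Q)\<close>.\<close>
  also have "\<dots> = int root_weight * ((\<Sum>m<Suc (card Q). int (coeff m) * int ((k - Suc m) choose (r - 1))) +
      int (coeff (Suc (card Q))) * int ((k - Suc (card Q)) choose r))"
    unfolding b_def using sum_by_parts_choose[of "Suc (card Q)" k r "\<lambda>m. int (coeff m)"] K(3) r
    by (simp only: k_def Suc_le_eq)
  also have "\<dots> = int (root_weight * (\<Sum>m\<le>card Q. coeff m * ((k - Suc m) choose (r - 1))))"
    unfolding lessThan_Suc_atMost by (simp add: coeff_def)
  finally show ?thesis unfolding k_def by (simp only: of_nat_eq_iff)
qed

end

subsection \<open>Arrowed arrays\<close>

text \<open>A closed subset of the domain never meets \<open>R\<close>. Conversely, the columns that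
  never reach \<open>R\<close> form a closed set, because a value outside the domain lies in
  \<open>R\<close>.\<close>

lemma leads_to_iff_acyclic_on:
  assumes ran: "ran \<psi> \<subseteq> dom \<psi> \<union> R" and disj: "R \<inter> dom \<psi> = {}"
  shows "leads_to \<psi> R \<longleftrightarrow> acyclic_on (dom \<psi>) (the \<circ> \<psi>)"
proof
  assume lt: "leads_to \<psi> R"
  show "acyclic_on (dom \<psi>) (the \<circ> \<psi>)"
    unfolding acyclic_on_def
  proof (intro allI impI)
    fix D assume D: "D \<subseteq> dom \<psi>" "(the \<circ> \<psi>) ` D \<subseteq> D"
    have step: "k \<in> D" if "j \<in> D" "(j, k) \<in> Map.graph \<psi> ^^ t" for j k t
      using that(2,1)
    proof (induction t arbitrary: k)
      case (Suc t)
      then obtain i where "i \<in> D" "(i, k) \<in> Map.graph \<psi>" by auto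
      then show ?case using D(2) by (force simp: Map.graph_def)
    qed simp
    show "D = {}"
    proof (rule ccontr)
      assume "D \<noteq> {}"
      then obtain j where j: "j \<in> D" by auto
      then have "j \<in> dom \<psi>" using D by auto
      then obtain t r where "r \<in> R" "(j, r) \<in> Map.graph \<psi> ^^ t"
        using lt unfolding leads_to_def by blast
      then show False using step[OF j] D disj by blast
    qed
  qed
next
  assume ac: "acyclic_on (dom \<psi>) (the \<circ> \<psi>)"
  define E where "E = {j \<in> dom \<psi>. \<not> (\<exists>t\<ge>1. \<exists>r\<in>R. (j, r) \<in> Map.graph \<psi> ^^ t)}"
  have "E = {}"
  proof (rule acyclic_onD[OF ac])
    fix j assume j: "j \<in> E"
    then obtain k where k: "\<psi> j = Some k" by (auto simp: E_def)
    have jk: "(j, k) \<in> Map.graph \<psi>" using k by (simp add: Map.graph_def)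
    have "k \<notin> R"
    proof
      assume "k \<in> R"
      moreover have "(j, k) \<in> Map.graph \<psi> ^^ 1" using jk by simp
      ultimately show False using j unfolding E_def by blast
    qed
    then have "k \<in> dom \<psi>" using ran k by (auto simp: ran_def)
    moreover have "\<not> (\<exists>t\<ge>1. \<exists>r\<in>R. (k, r) \<in> Map.graph \<psi> ^^ t)"
    proof
      assume "\<exists>t\<ge>1. \<exists>r\<in>R. (k, r) \<in> Map.graph \<psi> ^^ t"
      then obtain t r where "r \<in> R" "(k, r) \<in> Map.graph \<psi> ^^ t" by blast
      then have "(j, r) \<in> Map.graph \<psi> ^^ Suc t" using jk by (meson relpow_Suc_I2)
      then have "\<exists>t\<ge>1. \<exists>r\<in>R. (j, r) \<in> Map.graph \<psi> ^^ t"
        using \<open>r \<in> R\<close> by (intro exI[of _ "Suc t"]) (auto simp del: relpow.simps)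
      then show False using j unfolding E_def by blast
    qed
    ultimately show "(the \<circ> \<psi>) j \<in> E" using k by (simp add: E_def)
  qed (auto simp: E_def)
  then show "leads_to \<psi> R" unfolding leads_to_def E_def by blast
qed

lemma rooted_forest_acyclic_on:
  assumes "rooted_forest V (Map.graph \<phi>) P"
  shows "acyclic_on (dom \<phi>) (the \<circ> \<phi>)"
  unfolding acyclic_on_def
proof (intro allI impI)
  fix D assume D: "D \<subseteq> dom \<phi>" "(the \<circ> \<phi>) ` D \<subseteq> D"
  have fin: "finite (Map.graph \<phi>)" and ac: "acyclic (Map.graph \<phi>)"
    using assms finite_subset[of "Map.graph \<phi>" "V \<times> V"] by (auto simp: rooted_forest_def)
  show "D = {}"
  proof (rule ccontr)
    assume "D \<noteq> {}"
    then obtain z where z: "z \<in> D" "\<And>y. (y, z) \<in> (Map.graph \<phi>)\<inverse> \<Longrightarrow> y \<notin> D"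
      using wfE_min'[OF finite_acyclic_wf_converse[OF fin ac], of D] by blast
    obtain k where "\<phi> z = Some k" using z D by auto
    then show False using z D by (force simp: Map.graph_def)
  qed
qed

lemma card_subsets_containing:
  assumes "finite P" "p \<in> P" "r \<ge> 1"
  shows "card {R. R \<subseteq> P \<and> card R = r \<and> p \<in> R} = (card P - 1) choose (r - 1)"
proof -
  have "{R. R \<subseteq> P \<and> card R = r} =
      {R. R \<subseteq> P \<and> card R = r \<and> p \<in> R} \<union> {R. R \<subseteq> P \<and> card R = r \<and> {p} \<inter> R = {}}" by auto
  then have "card P choose r = card ({R. R \<subseteq> P \<and> card R = r \<and> p \<in> R} \<union> {R. R \<subseteq> P \<and> card R = r \<and> {p} \<inter> R = {}})"
    using n_subsets[OF assms(1), of r] by simp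
  also have "\<dots> = card {R. R \<subseteq> P \<and> card R = r \<and> p \<in> R} + card {R. R \<subseteq> P \<and> card R = r \<and> {p} \<inter> R = {}}"
    using assms by (intro card_Un_disjoint) auto
  also have "card {R. R \<subseteq> P \<and> card R = r \<and> {p} \<inter> R = {}} = (card P - 1) choose r"
    using card_subsets_avoiding[of P "{p}" r] assms by simp
  finally have e: "card P choose r = card {R. R \<subseteq> P \<and> card R = r \<and> p \<in> R} + ((card P - 1) choose r)" .
  have "card P > 0" using assms by (auto simp: card_gt_0_iff)
  then obtain n where "card P = Suc n" by (cases "card P") auto
  then show ?thesis using e assms(3) by (cases r) auto
qed

text \<open>This replaces the pairing of an array by a bijection, to which the counts above
  apply.\<close>

lemma bijection_relation_iff:
  "r \<subseteq> V \<times> W \<and> (\<forall>v\<in>V. \<exists>!w. (v, w) \<in> r) \<and> (\<forall>w\<in>W. \<exists>!v. (v, w) \<in> r) \<longleftrightarrow>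
   (\<exists>\<sigma>\<in>bijs V W. r = (\<lambda>v. (v, \<sigma> v)) ` V)" (is "?L \<longleftrightarrow> ?R")
proof
  assume L: ?L
  define \<sigma> where "\<sigma> = (\<lambda>v\<in>V. THE w. (v, w) \<in> r)"
  have \<sigma>: "(v, w) \<in> r \<longleftrightarrow> v \<in> V \<and> w = \<sigma> v" for v w
  proof (cases "v \<in> V")
    case True
    then have "\<exists>!w. (v, w) \<in> r" using L by blast
    then have "(v, \<sigma> v) \<in> r" "\<And>w. (v, w) \<in> r \<Longrightarrow> w = \<sigma> v"
      using True theI'[of "\<lambda>w. (v, w) \<in> r"] by (auto simp: \<sigma>_def)
    then show ?thesis using True by blast
  qed (use L in auto)
  have "bij_betw \<sigma> V W"
    unfolding bij_betw_def
  proof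
    show "inj_on \<sigma> V"
    proof (rule inj_onI)
      fix u v assume uv: "u \<in> V" "v \<in> V" "\<sigma> u = \<sigma> v"
      then have "(u, \<sigma> v) \<in> r" "(v, \<sigma> v) \<in> r" using \<sigma> by auto
      moreover have "\<sigma> v \<in> W" using \<sigma> uv L by blast
      ultimately show "u = v" using L by blast
    qed
    show "\<sigma> ` V = W"
    proof
      show "\<sigma> ` V \<subseteq> W" using \<sigma> L by blast
      show "W \<subseteq> \<sigma> ` V"
      proof
        fix w assume "w \<in> W"
        then obtain v where "(v, w) \<in> r" using L by blast
        then show "w \<in> \<sigma> ` V" using \<sigma> by blast
      qed
    qed
  qed
  moreover have "\<sigma> \<in> extensional V" by (simp add: \<sigma>_def)
  moreover have "r = (\<lambda>v. (v, \<sigma> v)) ` V" using \<sigma> by auto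
  ultimately show ?R by (auto simp: bijs_def)
next
  assume ?R
  then obtain \<sigma> where \<sigma>: "bij_betw \<sigma> V W" "r = (\<lambda>v. (v, \<sigma> v)) ` V" by (auto simp: bijs_def)
  have inj: "inj_on \<sigma> V" and im: "\<sigma> ` V = W" using \<sigma>(1) by (auto simp: bij_betw_def)
  have "\<exists>!v. (v, w) \<in> r" if "w \<in> W" for w
  proof -
    have "w \<in> \<sigma> ` V" using that im by simp
    then obtain v where v: "v \<in> V" "w = \<sigma> v" by blast
    have "u = v" if "(u, w) \<in> r" for u
      using that v inj unfolding \<sigma>(2) by (auto dest: inj_onD)
    then show ?thesis using v \<sigma>(2) by auto
  qed
  moreover have "\<exists>!w. (v, w) \<in> r" if "v \<in> V" for v using that \<sigma>(2) by auto
  moreover have "r \<subseteq> V \<times> W" using \<sigma>(2) im by auto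
  ultimately show ?L by blast
qed

section \<open>The forest condition in terms of a bijection\<close>

lemma finite_row_vertices: "finite (row_vertices K c)"
  by (simp add: row_vertices_def)

lemma card_row_vertices: "card (row_vertices K c) = (\<Sum>j\<in>{1..K}. c j)"
  by (simp add: row_vertices_def)

lemma fst_row_vertices: "fst ` row_vertices K c = {j \<in> {1..K}. c j > 0}"
  by (force simp: row_vertices_def image_iff)

definition last_vertex :: "(nat \<Rightarrow> nat) \<Rightarrow> nat \<Rightarrow> vertex" where
  "last_vertex c j = (j, c j - 1)"

lemma vertex_columns_row:
  assumes "Q \<subseteq> {j \<in> {1..K}. c j > 0}" "\<And>p. p \<in> Q \<Longrightarrow> rt p = p"
  shows "vertex_columns (row_vertices K c) fst (last_vertex c) Q rt"
proof
  show "finite (row_vertices K c)" by (rule finite_row_vertices)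
  fix j assume "j \<in> fst ` row_vertices K c"
  then show "last_vertex c j \<in> row_vertices K c"
    unfolding fst_row_vertices by (auto simp: row_vertices_def last_vertex_def)
  show "fst (last_vertex c j) = j" by (simp add: last_vertex_def)
qed (use assms in \<open>simp_all only: fst_row_vertices\<close>)

text \<open>The domain of \<open>psi1\<close> is \<open>dom \<phi> \<union> (P - R)\<close>: the
  cells of \<open>P - R\<close> are nonempty, and those outside \<open>dom \<phi> \<union> P\<close>
  are empty. Contracting \<open>dom \<phi>\<close> leaves a map on \<open>P - R\<close>. In row 2
  there are no arrows to contract.\<close>

lemma forest_condition_iff:
  fixes K :: nat and c :: "nat \<Rightarrow> nat" and \<phi> :: "nat \<rightharpoonup> nat" and R S :: "nat set" and \<sigma> :: "vertex \<Rightarrow> vertex"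
  defines "V \<equiv> row_vertices K c"
    and "\<alpha> \<equiv> \<lparr>cnt1 = c, cnt2 = c, marks1 = R, marks2 = S,
      pairing = (\<lambda>v. (v, \<sigma> v)) ` row_vertices K c\<rparr>"
  assumes \<sigma>: "bij_betw \<sigma> V V"
    and c0: "\<And>j. c j > 0 \<Longrightarrow> j \<in> dom \<phi> \<union> P" and P: "dom \<phi> \<union> P \<subseteq> {1..K}"
    and cQ: "\<And>j. j \<in> P - R \<Longrightarrow> c j > 0"
    and disj: "dom \<phi> \<inter> P = {}" and RP: "R \<subseteq> P" and ran: "ran \<phi> \<subseteq> dom \<phi> \<union> P"
    and acH: "acyclic_on (dom \<phi>) (the \<circ> \<phi>)"
    and rt: "\<And>j. j \<in> dom \<phi> \<Longrightarrow> rt (the (\<phi> j)) = rt j" "\<And>j. j \<in> dom \<phi> \<Longrightarrow> rt j \<notin> dom \<phi>"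
      "\<And>j. j \<notin> dom \<phi> \<Longrightarrow> rt j = j"
  shows "forest_condition (\<alpha>, \<phi>) \<longleftrightarrow> acyclic_on (P - R) (\<lambda>p. rt (fst (\<sigma> (last_vertex c p)))) \<and>
    acyclic_on (fst ` V - S) (\<lambda>j. fst (inv_into V \<sigma> (last_vertex c j)))"
proof -
  have inj: "inj_on \<sigma> V" and im: "\<sigma> ` V = V" using \<sigma> by (auto simp: bij_betw_def)
  have "j \<in> {1..K}" if "c j > 0" for j using c0[OF that] P by blast
  then have F: "fst ` V = {j. c j > 0}" unfolding V_def fst_row_vertices by blast
  have lV: "last_vertex c j \<in> V" if "c j > 0" for j
    using that F by (auto simp: V_def row_vertices_def last_vertex_def)
  have p1: "partner1 \<alpha> v = \<sigma> v" if "v \<in> V" for v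
    using that unfolding partner1_def \<alpha>_def V_def by (intro the_equality) auto
  have p2: "partner2 \<alpha> w = inv_into V \<sigma> w" if "w \<in> V" for w
    unfolding partner2_def
  proof (rule the_equality)
    have "inv_into V \<sigma> w \<in> V" "\<sigma> (inv_into V \<sigma> w) = w"
      using that im by (metis inv_into_into, metis f_inv_into_f)
    then have "(inv_into V \<sigma> w, w) \<in> (\<lambda>v. (v, \<sigma> v)) ` V" by force
    then show "(inv_into V \<sigma> w, w) \<in> pairing \<alpha>" by (simp add: \<alpha>_def V_def)
    fix v assume "(v, w) \<in> pairing \<alpha>"
    then have "v \<in> V" "w = \<sigma> v" by (auto simp: \<alpha>_def V_def)
    then show "v = inv_into V \<sigma> w" using inj by simp
  qed
  let ?p1 = "psi1 (\<alpha>, \<phi>)" and ?p2 = "psi2 (\<alpha>, \<phi>)"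
  have p1H: "?p1 j = \<phi> j" if "j \<in> dom \<phi>" for j
    using that disj RP by (auto simp: psi1_def \<alpha>_def)
  have p1Q: "?p1 j = Some (fst (\<sigma> (last_vertex c j)))" if "j \<in> P - R" for j
    using that disj cQ p1[OF lV] by (auto simp: psi1_def \<alpha>_def last_vertex_def)
  have p1N: "?p1 j = None" if "j \<notin> dom \<phi> \<union> (P - R)" for j
    using that disj c0[of j] by (auto simp: psi1_def \<alpha>_def)
  have d1: "dom ?p1 = dom \<phi> \<union> (P - R)"
  proof -
    have "j \<in> dom ?p1 \<longleftrightarrow> j \<in> dom \<phi> \<union> (P - R)" for j
    proof (cases "j \<in> dom \<phi> \<union> (P - R)")
      case True
      then have "?p1 j \<noteq> None" using p1H[of j] p1Q[of j] by (cases "\<phi> j = None") (simp_all add: domIff)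
      then show ?thesis using True by blast
    next
      case False
      then show ?thesis using p1N[OF False] by auto
    qed
    then show ?thesis by blast
  qed
  have r1: "ran ?p1 \<subseteq> dom ?p1 \<union> R"
  proof
    fix k assume "k \<in> ran ?p1"
    then obtain j where j: "?p1 j = Some k" by (auto simp: ran_def)
    then have "j \<in> dom ?p1" by blast
    then consider "j \<in> dom \<phi>" | "j \<in> P - R" unfolding d1 by blast
    then have "k \<in> dom \<phi> \<union> P"
    proof cases
      case 1
      then show ?thesis using ran j p1H by (auto simp: ran_def)
    next
      case 2
      then have "k = fst (\<sigma> (last_vertex c j))" using j p1Q by simp
      moreover have "\<sigma> (last_vertex c j) \<in> V" using lV[OF cQ[OF 2]] im by blast
      ultimately have "k \<in> fst ` V" by simp
      then show ?thesis using c0 F by auto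
    qed
    then show "k \<in> dom ?p1 \<union> R" unfolding d1 by blast
  qed
  have "leads_to ?p1 R \<longleftrightarrow> acyclic_on (dom \<phi> \<union> (P - R)) (the \<circ> ?p1)"
    unfolding d1[symmetric] by (rule leads_to_iff_acyclic_on[OF r1]) (use d1 RP disj in auto)
  also have "\<dots> \<longleftrightarrow> acyclic_on (P - R) (rt \<circ> (the \<circ> ?p1))"
  proof (rule acyclic_on_contract)
    show "acyclic_on (dom \<phi>) (the \<circ> ?p1)"
      using acH p1H acyclic_on_cong[of "dom \<phi>" "the \<circ> ?p1" "the \<circ> \<phi>"] by simp
  qed (use rt p1H disj in auto)
  also have "\<dots> \<longleftrightarrow> acyclic_on (P - R) (\<lambda>p. rt (fst (\<sigma> (last_vertex c p))))"
    by (rule acyclic_on_cong) (simp add: p1Q)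
  finally have A: "leads_to ?p1 R \<longleftrightarrow> acyclic_on (P - R) (\<lambda>p. rt (fst (\<sigma> (last_vertex c p))))" .
  have p2e: "?p2 j = (if j \<in> fst ` V - S then Some (fst (inv_into V \<sigma> (last_vertex c j))) else None)" for j
    using p2[OF lV, of j] unfolding F by (simp add: psi2_def \<alpha>_def last_vertex_def)
  have d2: "dom ?p2 = fst ` V - S"
  proof -
    have "j \<in> dom ?p2 \<longleftrightarrow> j \<in> fst ` V - S" for j unfolding dom_def mem_Collect_eq p2e by simp
    then show ?thesis by blast
  qed
  have r2: "ran ?p2 \<subseteq> dom ?p2 \<union> S"
  proof
    fix k assume "k \<in> ran ?p2"
    then obtain j where "?p2 j = Some k" by (auto simp: ran_def)
    then have j: "j \<in> fst ` V - S" "k = fst (inv_into V \<sigma> (last_vertex c j))"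
      unfolding p2e by (auto split: if_splits)
    have "last_vertex c j \<in> \<sigma> ` V" using j(1) lV F im by simp
    then have "inv_into V \<sigma> (last_vertex c j) \<in> V" by (rule inv_into_into)
    then show "k \<in> dom ?p2 \<union> S" unfolding d2 using j by blast
  qed
  have "leads_to ?p2 S \<longleftrightarrow> acyclic_on (fst ` V - S) (the \<circ> ?p2)"
    unfolding d2[symmetric] by (rule leads_to_iff_acyclic_on[OF r2]) (use d2 in auto)
  also have "\<dots> \<longleftrightarrow> acyclic_on (fst ` V - S) (\<lambda>j. fst (inv_into V \<sigma> (last_vertex c j)))"
    by (rule acyclic_on_cong) (simp add: p2e)
  finally show ?thesis using A by (simp add: forest_condition_def \<alpha>_def)
qed

text \<open>\<open>s_pos\<close> provides a vertex, as the forest counts require. For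
  \<open>s = 0\<close> every choice of the marks of row 2 would give an array, although the sum over
  A is empty.\<close>

locale forest_substructure =
  fixes K R1 s :: nat and x :: "nat \<Rightarrow> nat" and P :: "nat set" and \<phi> :: "nat \<rightharpoonup> nat"
  assumes params: "substructure_params K R1 s x P \<phi>"
    and forest: "rooted_forest (dom \<phi> \<union> P) (Map.graph \<phi>) P"
    and R1_pos: "1 \<le> R1" and s_pos: "1 \<le> s"
begin

lemma P_sub: "P \<subseteq> {1..K}" and P_card: "R1 \<le> card P"
  and dom_sub: "dom \<phi> \<subseteq> {1..K} - P" and ran_sub: "ran \<phi> \<subseteq> dom \<phi> \<union> P"
  and x_0: "j \<in> {1..K} \<Longrightarrow> j \<notin> dom \<phi> \<union> P \<Longrightarrow> x j = 0"
  using params unfolding substructure_params_def by auto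

lemma sum_x: "(\<Sum>j\<in>{1..K}. x j) + card P = s + R1"
proof -
  have "int (\<Sum>j\<in>{1..K}. x j) = int s - int (card P) + int R1"
    using params unfolding substructure_params_def by blast
  then show ?thesis by linarith
qed

lemma finite_P: "finite P"
  using P_sub finite_subset by blast

lemma acyclic_on_dom: "acyclic_on (dom \<phi>) (the \<circ> \<phi>)"
  using rooted_forest_acyclic_on[OF forest] .

definition rt :: "nat \<Rightarrow> nat" where
  "rt = (SOME rt. (\<forall>j\<in>dom \<phi>. rt (the (\<phi> j)) = rt j \<and> rt j \<notin> dom \<phi>) \<and> (\<forall>j. j \<notin> dom \<phi> \<longrightarrow> rt j = j))"

lemma rt: "j \<in> dom \<phi> \<Longrightarrow> rt (the (\<phi> j)) = rt j" "j \<in> dom \<phi> \<Longrightarrow> rt j \<notin> dom \<phi>"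
  "j \<notin> dom \<phi> \<Longrightarrow> rt j = j"
proof -
  have ex: "\<exists>rt. (\<forall>j\<in>dom \<phi>. rt (the (\<phi> j)) = rt j \<and> rt j \<notin> dom \<phi>) \<and> (\<forall>j. j \<notin> dom \<phi> \<longrightarrow> rt j = j)"
    using acyclic_on_exists_root[OF acyclic_on_dom] by simp
  have "(\<forall>j\<in>dom \<phi>. rt (the (\<phi> j)) = rt j \<and> rt j \<notin> dom \<phi>) \<and> (\<forall>j. j \<notin> dom \<phi> \<longrightarrow> rt j = j)"
    unfolding rt_def by (rule someI_ex[OF ex])
  then show "j \<in> dom \<phi> \<Longrightarrow> rt (the (\<phi> j)) = rt j" "j \<in> dom \<phi> \<Longrightarrow> rt j \<notin> dom \<phi>"
    "j \<notin> dom \<phi> \<Longrightarrow> rt j = j" by blast+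
qed

lemma rt_P: "p \<in> P \<Longrightarrow> rt p = p"
  using rt(3) dom_sub by blast

text \<open>Arrows stay in \<open>dom \<phi> \<union> P\<close>, so the columns of
  \<open>dom \<phi>\<close> whose root misses \<open>P\<close> would form a closed subset of
  \<open>dom \<phi>\<close>.\<close>

lemma rt_in_P: "j \<in> dom \<phi> \<union> P \<Longrightarrow> rt j \<in> P"
proof -
  have "{j \<in> dom \<phi>. rt j \<notin> P} = {}"
  proof (rule acyclic_onD[OF acyclic_on_dom])
    fix j assume j: "j \<in> {j \<in> dom \<phi>. rt j \<notin> P}"
    then obtain k where k: "\<phi> j = Some k" by auto
    then have "k \<in> dom \<phi> \<union> P" using ran_sub by (auto simp: ran_def)
    moreover have "rt k \<notin> P" using j k rt(1)[of j] by simp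
    ultimately have "k \<in> dom \<phi> \<and> rt k \<notin> P" using rt_P by auto
    then show "(the \<circ> \<phi>) j \<in> {j \<in> dom \<phi>. rt j \<notin> P}" using k by simp
  qed auto
  then show "j \<in> dom \<phi> \<union> P \<Longrightarrow> rt j \<in> P" using rt_P by auto
qed

section \<open>Parametrization by the marked sets and a bijection\<close>

definition roots :: "nat set set" where
  "roots = {R. R \<subseteq> P \<and> card R = R1}"

text \<open>The value 0 outside \<open>dom \<phi> \<union> P\<close> is forced rather than
  prescribed: the other cells already hold \<open>s\<close> vertices.\<close>

definition cell_size :: "nat set \<Rightarrow> nat \<Rightarrow> nat" where
  "cell_size R j = (if j \<in> dom \<phi> \<union> P then if j \<in> P \<and> j \<notin> R then x j + 1 else x j else 0)"

abbreviation "V R \<equiv> row_vertices K (cell_size R)"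

lemma cell_size_pos: "j \<in> P - R \<Longrightarrow> cell_size R j > 0" and cell_size_posD: "cell_size R j > 0 \<Longrightarrow> j \<in> dom \<phi> \<union> P"
  by (auto simp: cell_size_def split: if_splits)

lemma sum_cell_size:
  assumes "R \<in> roots"
  shows "(\<Sum>j\<in>{1..K}. cell_size R j) = s"
proof -
  have R: "R \<subseteq> P" "card R = R1" using assms by (auto simp: roots_def)
  have "(\<Sum>j\<in>{1..K}. cell_size R j) = (\<Sum>j\<in>{1..K}. x j + (if j \<in> P - R then 1 else 0))"
    by (rule sum.cong) (use x_0 in \<open>auto simp: cell_size_def\<close>)
  also have "\<dots> = (\<Sum>j\<in>{1..K}. x j) + card {j \<in> {1..K}. j \<in> P - R}"
    by (simp only: sum.distrib sum.inter_filter[symmetric] finite_atLeastAtMost card_eq_sum)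
  also have "{j \<in> {1..K}. j \<in> P - R} = P - R" using P_sub by auto
  also have "card (P - R) = card P - R1"
    using R finite_P finite_subset by (metis card_Diff_subset)
  finally show ?thesis using sum_x P_card by simp
qed

lemma card_V: "R \<in> roots \<Longrightarrow> card (V R) = s"
  by (simp only: card_row_vertices sum_cell_size)

lemma vertex_columns_V: "vertex_columns (V R) fst (last_vertex (cell_size R)) (P - R) rt"
  using P_sub cell_size_pos rt_P by (intro vertex_columns_row) auto

definition array :: "nat set \<Rightarrow> nat set \<Rightarrow> (vertex \<Rightarrow> vertex) \<Rightarrow> varray" where
  "array R S \<sigma> = \<lparr>cnt1 = cell_size R, cnt2 = cell_size R, marks1 = R, marks2 = S,
    pairing = (\<lambda>v. (v, \<sigma> v)) ` V R\<rparr>"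

definition good :: "nat set \<Rightarrow> nat set \<Rightarrow> (vertex \<Rightarrow> vertex) set" where
  "good R S = {\<sigma> \<in> bijs (V R) (V R). forest_condition (array R S \<sigma>, \<phi>)}"

lemma substructure_eq:
  "substructure K R1 R2 s x P \<phi> = (\<lambda>(R, S, \<sigma>). (array R S \<sigma>, \<phi>)) `
    (SIGMA R:roots. SIGMA S:{S. S \<subseteq> {1..K} \<and> card S = R2}. good R S)" (is "?L = ?f ` ?I")
proof
  show "?L \<subseteq> ?f ` ?I"
  proof
    fix a assume a: "a \<in> ?L"
    then obtain \<alpha> where \<alpha>: "a = (\<alpha>, \<phi>)" by (auto simp: substructure_def)
    define R S where "R = marks1 \<alpha>" and "S = marks2 \<alpha>"
    have va: "vertical_array K R1 R2 s \<alpha>" and fc: "forest_condition (\<alpha>, \<phi>)"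
      and bal: "balanced K (\<alpha>, \<phi>)" and RP: "R \<subseteq> P"
      and cells: "\<forall>j\<in>dom \<phi> \<union> P. let n = (if j \<in> P \<and> j \<notin> R then x j + 1 else x j)
        in cnt1 \<alpha> j = n \<and> cnt2 \<alpha> j = n"
      using a unfolding \<alpha> substructure_def AR_def R_def by auto
    have R: "R \<in> roots" and S: "S \<subseteq> {1..K}" "card S = R2"
      using va RP by (auto simp: vertical_array_def roots_def R_def S_def)
    have out: "cnt1 \<alpha> j = 0" "cnt2 \<alpha> j = 0" if "j \<notin> {1..K}" for j
      using va that unfolding vertical_array_def by blast+
    have cell_size_out: "cell_size R j = 0" if "j \<notin> {1..K}" for j
      using that P_sub dom_sub by (auto simp: cell_size_def)
    \<comment> \<open>A pointwise inequality between functions with equal sums is an equality; this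
      empties the columns that the substructure does not mention.\<close>
    have inside: "cnt1 \<alpha> j = cell_size R j" if "j \<in> {1..K}" for j
    proof -
      have "cell_size R i \<le> cnt1 \<alpha> i" for i
        using cells by (auto simp: cell_size_def Let_def)
      moreover have "(\<Sum>i\<in>{1..K}. cell_size R i) = (\<Sum>i\<in>{1..K}. cnt1 \<alpha> i)"
        using va sum_cell_size[OF R] by (simp add: vertical_array_def)
      ultimately show ?thesis using sum_mono_inv[of "cell_size R" "{1..K}" "cnt1 \<alpha>" j] that by simp
    qed
    have c1: "cnt1 \<alpha> = cell_size R"
    proof
      show "cnt1 \<alpha> j = cell_size R j" for j
        using inside out cell_size_out by (cases "j \<in> {1..K}") auto
    qed
    have c2: "cnt2 \<alpha> = cell_size R"
    proof
      show "cnt2 \<alpha> j = cell_size R j" for j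
        using inside out cell_size_out bal by (cases "j \<in> {1..K}") (auto simp: balanced_def)
    qed
    have "pairing \<alpha> \<subseteq> V R \<times> V R \<and> (\<forall>v\<in>V R. \<exists>!w. (v, w) \<in> pairing \<alpha>) \<and> (\<forall>w\<in>V R. \<exists>!v. (v, w) \<in> pairing \<alpha>)"
      using va unfolding vertical_array_def c1 c2 by (elim conjE) (intro conjI; assumption)
    then obtain \<sigma> where \<sigma>: "\<sigma> \<in> bijs (V R) (V R)" "pairing \<alpha> = (\<lambda>v. (v, \<sigma> v)) ` V R"
      unfolding bijection_relation_iff by (rule bexE)
    have "\<alpha> = array R S \<sigma>"
      using c1 c2 \<sigma>(2) by (cases \<alpha>) (simp add: array_def R_def S_def)
    moreover have "\<sigma> \<in> good R S" using \<sigma>(1) fc calculation by (simp add: good_def)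
    ultimately show "a \<in> ?f ` ?I" using R S \<alpha> by (intro image_eqI[of _ _ "(R, S, \<sigma>)"]) auto
  qed
  show "?f ` ?I \<subseteq> ?L"
  proof
    fix a assume "a \<in> ?f ` ?I"
    then obtain R S \<sigma> where R: "R \<in> roots" and S: "S \<subseteq> {1..K}" "card S = R2"
      and \<sigma>: "\<sigma> \<in> good R S" and a: "a = (array R S \<sigma>, \<phi>)" by auto
    have RP: "R \<subseteq> P" "card R = R1" using R by (auto simp: roots_def)
    let ?r = "(\<lambda>v. (v, \<sigma> v)) ` V R"
    have r: "?r \<subseteq> V R \<times> V R \<and> (\<forall>v\<in>V R. \<exists>!w. (v, w) \<in> ?r) \<and> (\<forall>w\<in>V R. \<exists>!v. (v, w) \<in> ?r)"
      unfolding bijection_relation_iff using \<sigma> by (auto simp: good_def)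
    have out: "\<forall>j. j \<notin> {1..K} \<longrightarrow> cell_size R j = 0 \<and> cell_size R j = 0"
      using P_sub dom_sub by (auto simp: cell_size_def)
    have RK: "R \<subseteq> {1..K}" using RP P_sub by auto
    have "vertical_array K R1 R2 s (array R S \<sigma>)"
      unfolding vertical_array_def array_def varray.simps
      by (intro conjI out sum_cell_size[OF R] RK RP(2) S r[THEN conjunct1] r[THEN conjunct2, THEN conjunct1]
        r[THEN conjunct2, THEN conjunct2])
    moreover have "forest_condition (array R S \<sigma>, \<phi>)" using \<sigma> by (simp add: good_def)
    moreover have "dom \<phi> \<subseteq> {1..K} - R" "ran \<phi> \<subseteq> {1..K}"
      using dom_sub ran_sub P_sub RP by blast+
    ultimately have "a \<in> AR K R1 R2 s" by (simp add: a AR_def array_def)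
    then show "a \<in> ?L" using RP by (auto simp: a substructure_def array_def balanced_def cell_size_def Let_def)
  qed
qed

lemma inj_array:
  "inj_on (\<lambda>(R, S, \<sigma>). (array R S \<sigma>, \<phi>)) (SIGMA R:roots. SIGMA S:B. good R S)"
proof (rule inj_onI)
  fix a b
  assume a: "a \<in> (SIGMA R:roots. SIGMA S:B. good R S)" and b: "b \<in> (SIGMA R:roots. SIGMA S:B. good R S)"
    and ab: "(\<lambda>(R, S, \<sigma>). (array R S \<sigma>, \<phi>)) a = (\<lambda>(R, S, \<sigma>). (array R S \<sigma>, \<phi>)) b"
  obtain R S \<sigma> R' S' \<sigma>' where e: "a = (R, S, \<sigma>)" "b = (R', S', \<sigma>')" by (metis prod_cases3)
  have "\<sigma> \<in> good R S" "\<sigma>' \<in> good R' S'" and eq: "array R S \<sigma> = array R' S' \<sigma>'"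
    using a b ab by (simp_all add: e)
  then have ext: "\<sigma> \<in> extensional (V R)" "\<sigma>' \<in> extensional (V R')" by (auto simp: good_def bijs_def)
  have RS: "R = R'" "S = S'" using eq by (simp_all add: array_def)
  then have graphs: "(\<lambda>v. (v, \<sigma> v)) ` V R = (\<lambda>v. (v, \<sigma>' v)) ` V R" using eq by (simp add: array_def)
  have "\<sigma> v = \<sigma>' v" if "v \<in> V R" for v
  proof -
    have "(v, \<sigma> v) \<in> (\<lambda>v. (v, \<sigma>' v)) ` V R" unfolding graphs[symmetric] using that by blast
    then show ?thesis by auto
  qed
  then have "\<sigma> = \<sigma>'" using ext RS by (intro extensionalityI[of _ "V R"]) auto
  then show "a = b" using RS e by simp
qed

text \<open>A column with root in \<open>R\<close> belongs to \<open>dom \<phi>\<close> or to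
  \<open>R\<close>, so its cell has exactly \<open>x j\<close> vertices. Hence
  \<open>root_weight\<close> is the first factor, and the second is the same for all
  \<open>R\<close>.\<close>

lemma sum_good:
  assumes R: "R \<in> roots" and R2: "1 \<le> R2"
  shows "(\<Sum>S | S \<subseteq> {1..K} \<and> card S = R2. card (good R S)) =
    (\<Sum>j\<in>dom \<phi> \<union> P. if rt j \<in> R then x j else 0) *
    (\<Sum>m\<le>card P - R1. ((card P - R1) choose m) * fact m * (if m < s then fact (s - Suc m) else 0) *
      ((K - Suc m) choose (R2 - 1)))"
proof -
  interpret vc: vertex_columns "V R" fst "last_vertex (cell_size R)" "P - R" rt
    by (rule vertex_columns_V)
  have RP: "R \<subseteq> P" "card R = R1" using R by (auto simp: roots_def)
  have cQ: "card (P - R) = card P - R1" using RP finite_P finite_subset by (metis card_Diff_subset)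
  have disj: "dom \<phi> \<inter> P = {}" and sub: "dom \<phi> \<union> P \<subseteq> {1..K}" using dom_sub P_sub by auto
  have good: "good R S = {\<sigma> \<in> vc.forest_bijs. acyclic_on (fst ` V R - S) (vc.column_map \<sigma>)}" for S
  proof -
    have "forest_condition (array R S \<sigma>, \<phi>) \<longleftrightarrow>
        acyclic_on (P - R) (\<lambda>p. rt (fst (\<sigma> (last_vertex (cell_size R) p)))) \<and>
        acyclic_on (fst ` V R - S) (\<lambda>j. fst (inv_into (V R) \<sigma> (last_vertex (cell_size R) j)))"
      if "bij_betw \<sigma> (V R) (V R)" for \<sigma>
      unfolding array_def
      by (rule forest_condition_iff[OF that cell_size_posD sub cell_size_pos disj RP(1) ran_sub acyclic_on_dom rt])
    moreover have "vc.column_map \<sigma> = (\<lambda>j. fst (inv_into (V R) \<sigma> (last_vertex (cell_size R) j)))" for \<sigma>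
      by (simp add: fun_eq_iff vc.column_map_def)
    ultimately show ?thesis unfolding good_def vc.forest_bijs_def vc.root_of_def bijs_def by auto
  qed
  have V0: "V R \<noteq> {}"
  proof
    assume "V R = {}"
    then show False using card_V[OF R] s_pos by simp
  qed
  have "card P \<le> K" using card_mono[OF _ P_sub] by simp
  then have qK: "card (P - R) < card {1..K}" using cQ R1_pos P_card by simp
  have "fst ` V R \<subseteq> {1..K}" by (auto simp: fst_row_vertices)
  then have "(\<Sum>S | S \<subseteq> {1..K} \<and> card S = R2. card (good R S)) =
    vc.root_weight * (\<Sum>m\<le>card (P - R). vc.coeff m * ((card {1..K} - Suc m) choose (R2 - 1)))"
    unfolding good by (rule vc.sum_columns_marked[OF finite_atLeastAtMost _ qK R2 V0])
  moreover have "vc.root_weight = (\<Sum>j\<in>dom \<phi> \<union> P. if rt j \<in> R then x j else 0)"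
  proof -
    have "{w \<in> V R. vc.root_of w \<notin> P - R} = (SIGMA j:{j \<in> {1..K}. rt j \<notin> P - R}. {..<cell_size R j})"
      by (auto simp: row_vertices_def vc.root_of_def)
    then have "vc.root_weight = (\<Sum>j\<in>{j \<in> {1..K}. rt j \<notin> P - R}. cell_size R j)"
      by (simp add: vc.root_weight_def)
    also have "\<dots> = (\<Sum>j\<in>{1..K}. if rt j \<notin> P - R then cell_size R j else 0)"
      by (rule sum.inter_filter) simp
    also have "\<dots> = (\<Sum>j\<in>dom \<phi> \<union> P. if rt j \<notin> P - R then cell_size R j else 0)"
      by (rule sum.mono_neutral_right) (use sub in \<open>auto simp: cell_size_def\<close>)
    also have "\<dots> = (\<Sum>j\<in>dom \<phi> \<union> P. if rt j \<in> R then x j else 0)"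
    proof (rule sum.cong[OF refl])
      fix j assume "j \<in> dom \<phi> \<union> P"
      then show "(if rt j \<notin> P - R then cell_size R j else 0) = (if rt j \<in> R then x j else 0)"
        using rt_in_P[of j] rt_P[of j] by (auto simp: cell_size_def)
    qed
    finally show ?thesis .
  qed
  ultimately show ?thesis unfolding vc.coeff_def cQ card_V[OF R] card_atLeastAtMost by simp
qed

text \<open>Double counting: column \<open>j\<close> contributes \<open>x j\<close> for each
  \<open>R\<close> containing its root, and the number of such \<open>R\<close> does not depend on
  the root.\<close>

lemma card_substructure:
  assumes R2: "1 \<le> R2"
  shows "card (substructure K R1 R2 s x P \<phi>) =
    (s + R1 - card P) * ((card P - 1) choose (R1 - 1)) *
    (\<Sum>m\<le>card P - R1. ((card P - R1) choose m) * fact m * (if m < s then fact (s - Suc m) else 0) *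
      ((K - Suc m) choose (R2 - 1)))"
proof -
  define Z where "Z = (\<Sum>m\<le>card P - R1. ((card P - R1) choose m) * fact m *
      (if m < s then fact (s - Suc m) else 0) * ((K - Suc m) choose (R2 - 1)))"
  let ?B = "{S. S \<subseteq> {1..K} \<and> card S = R2}"
  have finR: "finite roots" using finite_P by (simp add: roots_def)
  have sub: "dom \<phi> \<union> P \<subseteq> {1..K}" using dom_sub P_sub by auto
  have fin_good: "finite (good R S)" for R S
    using finite_bijs[OF finite_row_vertices finite_row_vertices] by (simp add: good_def)
  have "card (substructure K R1 R2 s x P \<phi>) = card (SIGMA R:roots. SIGMA S:?B. good R S)"
    unfolding substructure_eq by (rule card_image[OF inj_array])
  also have "\<dots> = (\<Sum>R\<in>roots. \<Sum>S\<in>?B. card (good R S))"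
    using finR fin_good by simp
  also have "\<dots> = (\<Sum>R\<in>roots. (\<Sum>j\<in>dom \<phi> \<union> P. if rt j \<in> R then x j else 0) * Z)"
    unfolding Z_def by (rule sum.cong[OF refl]) (rule sum_good[OF _ R2])
  also have "\<dots> = (\<Sum>j\<in>dom \<phi> \<union> P. \<Sum>R\<in>roots. if rt j \<in> R then x j else 0) * Z"
    by (subst sum.swap) (simp only: sum_distrib_right)
  also have "(\<Sum>j\<in>dom \<phi> \<union> P. \<Sum>R\<in>roots. if rt j \<in> R then x j else 0) =
      (\<Sum>j\<in>dom \<phi> \<union> P. x j * ((card P - 1) choose (R1 - 1)))"
  proof (rule sum.cong[OF refl])
    fix j assume j: "j \<in> dom \<phi> \<union> P"
    have "(\<Sum>R\<in>roots. if rt j \<in> R then x j else 0) = (\<Sum>R\<in>{R \<in> roots. rt j \<in> R}. x j)"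
      by (rule sum.inter_filter[OF finR, symmetric])
    also have "{R \<in> roots. rt j \<in> R} = {R. R \<subseteq> P \<and> card R = R1 \<and> rt j \<in> R}" by (auto simp: roots_def)
    finally show "(\<Sum>R\<in>roots. if rt j \<in> R then x j else 0) = x j * ((card P - 1) choose (R1 - 1))"
      using card_subsets_containing[OF finite_P rt_in_P[OF j] R1_pos] by simp
  qed
  also have "\<dots> = (\<Sum>j\<in>{1..K}. x j) * ((card P - 1) choose (R1 - 1))"
    unfolding sum_distrib_right[symmetric]
    by (rule arg_cong[of _ _ "\<lambda>n. n * _"], rule sum.mono_neutral_left) (use sub x_0 in auto)
  also have "(\<Sum>j\<in>{1..K}. x j) = s + R1 - card P" using sum_x by simp
  finally show ?thesis unfolding Z_def .
qed

end

text \<open>The factorials of \<open>p - R1\<close> in the first two factors cancel. If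
  \<open>R2 + m > K\<close>, the last binomial and the reciprocal factorial replacing it are both
  0.\<close>

lemma choose_inv_fact_eq:
  assumes "R1 \<ge> 1" "R1 \<le> p" "p \<le> K" "R2 \<ge> 1" "m \<le> p - R1"
  shows "real ((p - 1) choose (R1 - 1)) * real (((p - R1) choose m) * fact m) * real ((K - Suc m) choose (R2 - 1)) =
    fact (K - m - 1) * fact (p - 1) * inv_fact (int p - int R1 - int m) * inv_fact (int K - int R2 - int m)
      / (fact (R1 - 1) * fact (R2 - 1))"
proof -
  have "real ((p - 1) choose (R1 - 1)) = fact (p - 1) / (fact (R1 - 1) * fact (p - R1))"
    using assms binomial_fact[of "R1 - 1" "p - 1", where ?'a = real] by simp
  moreover have "real (((p - R1) choose m) * fact m) = fact (p - R1) * inv_fact (int p - int R1 - int m)"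
  proof -
    have "nat (int p - int R1 - int m) = p - R1 - m" "int p - int R1 - int m \<ge> 0" using assms by auto
    then have "inv_fact (int p - int R1 - int m) = 1 / fact (p - R1 - m)" by (simp add: inv_fact_def)
    then show ?thesis using assms binomial_fact[of m "p - R1", where ?'a = real] by simp
  qed
  moreover have "real ((K - Suc m) choose (R2 - 1)) =
      fact (K - m - 1) * inv_fact (int K - int R2 - int m) / fact (R2 - 1)"
  proof (cases "R2 + m \<le> K")
    case True
    then have "nat (int K - int R2 - int m) = K - R2 - m" "int K - int R2 - int m \<ge> 0" by auto
    then have "inv_fact (int K - int R2 - int m) = 1 / fact (K - R2 - m)" by (simp add: inv_fact_def)
    moreover have "K - Suc m - (R2 - 1) = K - R2 - m" using assms by simp
    ultimately show ?thesis
      using True assms binomial_fact[of "R2 - 1" "K - Suc m", where ?'a = real] by simp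
  next
    case False
    then show ?thesis using assms by (simp add: inv_fact_def binomial_eq_0)
  qed
  ultimately show ?thesis by simp
qed

theorem theorem4p6:
  fixes K s R1 R2 :: nat
    and x :: "nat \<Rightarrow> nat"
    and P :: "nat set"
    and \<phi> :: "nat \<rightharpoonup> nat"
  assumes "K \<ge> 1" and "s \<ge> 1"
    and "1 \<le> R1" and "R1 \<le> K" and "1 \<le> R2" and "R2 \<le> K"
    and "substructure_params K R1 s x P \<phi>"
    and "rooted_forest (dom \<phi> \<union> P) (Map.graph \<phi>) P"
  shows "real (card (substructure K R1 R2 s x P \<phi>)) =
    (\<Sum>A<min s K.
       (real s - real (card P) + real R1) * fact (K - A - 1) * fact (s - A - 1) * fact (card P - 1)
       * inv_fact (int (card P) - int R1 - int A) * inv_fact (int K - int R2 - int A)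
       / (fact (R1 - 1) * fact (R2 - 1)))"
proof -
  interpret forest_substructure K R1 s x P \<phi>
    using assms by unfold_locales auto
  define p q where "p = card P" and "q = p - R1"
  let ?X = "real s - real p + real R1"
  let ?t = "\<lambda>m. ?X * fact (K - m - 1) * fact (s - m - 1) * fact (p - 1)
       * inv_fact (int p - int R1 - int m) * inv_fact (int K - int R2 - int m)
       / (fact (R1 - 1) * fact (R2 - 1))"
  have pK: "p \<le> K" using card_mono[OF _ P_sub] by (simp add: p_def)
  have R1p: "R1 \<le> p" using P_card by (simp add: p_def)
  \<comment> \<open>The natural subtraction is exact, because \<open>sum_x\<close> implies
    \<open>p \<le> s + R1\<close>.\<close>
  have X: "real (s + R1 - p) = ?X" using sum_x by (simp add: p_def of_nat_diff)
  have "real (card (substructure K R1 R2 s x P \<phi>)) =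
      (\<Sum>m\<le>q. ?X * real ((p - 1) choose (R1 - 1)) * (real ((q choose m) * fact m) *
        (if m < s then fact (s - Suc m) else 0) * real ((K - Suc m) choose (R2 - 1))))"
    unfolding card_substructure[OF assms(5)] p_def[symmetric] q_def[symmetric] of_nat_mult X[symmetric]
      of_nat_sum sum_distrib_left by (intro sum.cong refl) simp
  also have "\<dots> = (\<Sum>m\<le>q. if m < s then ?t m else 0)"
  proof (rule sum.cong[OF refl])
    fix m assume "m \<in> {..q}"
    then have m: "m \<le> p - R1" by (simp add: q_def)
    let ?f = "if m < s then fact (s - Suc m) else 0 :: real"
    have "?X * real ((p - 1) choose (R1 - 1)) * (real ((q choose m) * fact m) * ?f * real ((K - Suc m) choose (R2 - 1))) =
        ?X * ?f * (real ((p - 1) choose (R1 - 1)) * real ((q choose m) * fact m) * real ((K - Suc m) choose (R2 - 1)))"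
      by (simp only: mult_ac)
    also have "\<dots> = (if m < s then ?t m else 0)"
      unfolding q_def choose_inv_fact_eq[OF assms(3) R1p pK assms(5) m] by (simp add: mult_ac)
    finally show "?X * real ((p - 1) choose (R1 - 1)) * (real ((q choose m) * fact m) * ?f *
        real ((K - Suc m) choose (R2 - 1))) = (if m < s then ?t m else 0)" .
  qed
  also have "\<dots> = sum ?t {m \<in> {..q}. m < s}"
    by (rule sum.inter_filter[symmetric]) simp
  \<comment> \<open>Since \<open>R1 \<ge> 1\<close> gives \<open>q < K\<close>, the old range is
    contained in the new one; the added terms have \<open>m > q\<close> and vanish through
    \<open>inv_fact\<close>.\<close>
  also have "\<dots> = sum ?t {..<min s K}"
  proof (rule sum.mono_neutral_left)
    show "{m \<in> {..q}. m < s} \<subseteq> {..<min s K}" using R1p pK assms(3) by (auto simp: q_def)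
    show "\<forall>m\<in>{..<min s K} - {m \<in> {..q}. m < s}. ?t m = 0"
      using R1p by (auto simp: q_def inv_fact_def)
  qed simp
  finally show ?thesis by (simp add: p_def)
qed

end
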